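(* There are universal constants $c,c'>0$ such that for any $M,K,R\ge1$, $\lambda>0$, $H\ge9\lambda$, $\Delta>0$, $\sigma\ge0$ and any $F\in\mathcal{F}_\lambda(H,\Delta,M)$, the output $\hat x$ of Minibatch AC-SA (in the multi-stage form for strongly convex objectives, with suitably chosen parameters, in the heterogeneous intermittent communication setting) has suboptimality at most $$\mathbb{E}F(\hat x)-F^*\le c\left(\Delta\exp\Big(-\frac{c'\sqrt\lambda R}{\sqrt H}\Big)+\min\left\{\frac{\sigma^2}{\lambda MKR},\ \Delta\right\}\right).$$
   Context: $\mathcal{F}_\lambda(H,\Delta)$: $\lambda$-strongly convex, $H$-smooth (gradient $H$-Lipschitz) functions $F:\mathbb{R}^d\to\mathbb{R}$, $d\in\mathbb N$, with $F(0)-\min_xF(x)\le\Delta$. $\mathcal{F}_\lambda(H,\Delta,M)$: all objectives $F(x)=\frac1M\sum_{m=1}^MF_m(x)$ with $F\in\mathcal{F}_\lambda(H,\Delta)$ (no assumption on the individual components beyond differentiability). $F^*=\min F$. Heterogeneous intermittent communication setting: $M$ machines, $R$ rounds of communication, $K$ oracle queries per machine per round; each query of machine $m$ at $x$ returns an independent stochastic gradient with mean $\nabla F_m(x)$ and variance $\mathbb{E}\|\cdot-\nabla F_m(x)\|^2\le\sigma^2$. AC-SA with $T$ iterations from a starting point $x_0$ and stochastic gradients $g_t(\cdot)$: $x^{\mathrm{ag}}_0=x_0$; for $t=0,\dots,T-1$: $x^{\mathrm{md}}_{t+1}=\beta_t^{-1}x_t+(1-\beta_t^{-1})x^{\mathrm{ag}}_t$;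 $x_{t+1}=x_t-\gamma_t\,g_t(x^{\mathrm{md}}_{t+1})$; $x^{\mathrm{ag}}_{t+1}=\beta_t^{-1}x_{t+1}+(1-\beta_t^{-1})x^{\mathrm{ag}}_t$; output $x^{\mathrm{ag}}_T$, with parameters $\beta_t\ge1$, $\gamma_t\ge0$. Multi-stage form: the iterations are split into consecutive stages, the first started at $0$ and each later stage being AC-SA restarted at the output of the previous stage, with stage lengths and parameters chosen depending on $H,\lambda,\Delta,\sigma,M,K,R$; $\hat x$ is the output of the last stage. Minibatch AC-SA performs $R$ iterations in total, one per round, each using the average of the $MK$ stochastic gradients computed in that round at a common point ($K$ on each of the $M$ machines). *)

theory Defs
  imports "HOL-Probability.Probability"
begin

(* The constants of the theorem must not depend on the dimension, so d is a number rather than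
   a type: a vector of R^d is a sequence vanishing from index d on (the points of
   Euclidean_space d). Objectives are total functions on sequences, but only their values on
   Rd d matter. *)

type_synonym vec = "nat \<Rightarrow> real"

definition Rd :: "nat \<Rightarrow> vec set" where
  "Rd d = {x. \<forall>i\<ge>d. x i = 0}"

definition vnorm :: "nat \<Rightarrow> vec \<Rightarrow> real" where
  "vnorm d x = L2_set x {..<d}"

definition vdist :: "nat \<Rightarrow> vec \<Rightarrow> vec \<Rightarrow> real" where
  "vdist d x y = vnorm d (\<lambda>i. x i - y i)"

definition vinner :: "nat \<Rightarrow> vec \<Rightarrow> vec \<Rightarrow> real" where
  "vinner d x y = (\<Sum>i<d. x i * y i)"

(* The Borel sets of sequences are those of the product topology; their traces on Rd d are the
   usual Borel sets of R^d. *)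
definition borel_Rd :: "nat \<Rightarrow> vec measure" where
  "borel_Rd d = restrict_space borel (Rd d)"

definition has_gradient :: "nat \<Rightarrow> (vec \<Rightarrow> real) \<Rightarrow> vec \<Rightarrow> vec \<Rightarrow> bool" where
  "has_gradient d F x g \<longleftrightarrow> g \<in> Rd d \<and>
     (\<forall>\<epsilon>>0. \<exists>\<delta>>0. \<forall>y\<in>Rd d. vdist d y x < \<delta> \<longrightarrow>
        \<bar>F y - F x - vinner d g (\<lambda>i. y i - x i)\<bar> \<le> \<epsilon> * vdist d y x)"

definition differentiable_Rd :: "nat \<Rightarrow> (vec \<Rightarrow> real) \<Rightarrow> bool" where
  "differentiable_Rd d F \<longleftrightarrow> (\<forall>x\<in>Rd d. \<exists>g. has_gradient d F x g)"

definition smooth :: "nat \<Rightarrow> real \<Rightarrow> (vec \<Rightarrow> real) \<Rightarrow> bool" where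
  "smooth d H F \<longleftrightarrow> (\<exists>G. (\<forall>x\<in>Rd d. has_gradient d F x (G x)) \<and>
     (\<forall>x\<in>Rd d. \<forall>y\<in>Rd d. vdist d (G x) (G y) \<le> H * vdist d x y))"

definition strongly_convex :: "nat \<Rightarrow> real \<Rightarrow> (vec \<Rightarrow> real) \<Rightarrow> bool" where
  "strongly_convex d l F \<longleftrightarrow> (\<forall>x\<in>Rd d. \<forall>y\<in>Rd d. \<forall>t\<in>{0..1}.
     F (\<lambda>i. (1 - t) * x i + t * y i)
       \<le> (1 - t) * F x + t * F y - l / 2 * t * (1 - t) * (vdist d x y)\<^sup>2)"

(* For strongly convex smooth F (the only use) this infimum is attained, i.e. it is min F. *)
definition min_value :: "nat \<Rightarrow> (vec \<Rightarrow> real) \<Rightarrow> real" where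
  "min_value d F = (INF x\<in>Rd d. F x)"

definition objective_class :: "nat \<Rightarrow> real \<Rightarrow> real \<Rightarrow> real \<Rightarrow> (vec \<Rightarrow> real) set" where
  "objective_class d l H \<Delta> =
     {F. strongly_convex d l F \<and> smooth d H F \<and> F (\<lambda>_. 0) - min_value d F \<le> \<Delta>}"

definition average_objective :: "nat \<Rightarrow> (nat \<Rightarrow> vec \<Rightarrow> real) \<Rightarrow> vec \<Rightarrow> real" where
  "average_objective M Fs x = (\<Sum>m<M. Fs m x) / real M"

(* Given by the family of components, since the oracles refer to these. *)
definition het_objective_class ::
    "nat \<Rightarrow> real \<Rightarrow> real \<Rightarrow> real \<Rightarrow> nat \<Rightarrow> (nat \<Rightarrow> vec \<Rightarrow> real) set" where
  "het_objective_class d l H \<Delta> M =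
     {Fs. (\<forall>m<M. differentiable_Rd d (Fs m)) \<and>
          average_objective M Fs \<in> objective_class d l H \<Delta>}"

(* A stochastic oracle is a Markov kernel: orc x is the law of the answer to a query at x, and
   each query is answered by a fresh independent draw from it. The nonnegative integral makes
   the variance bound meaningful without presupposing integrability. *)
definition stochastic_gradient_oracle ::
    "nat \<Rightarrow> real \<Rightarrow> (vec \<Rightarrow> real) \<Rightarrow> (vec \<Rightarrow> vec measure) \<Rightarrow> bool" where
  "stochastic_gradient_oracle d \<sigma> F orc \<longleftrightarrow>
     orc \<in> borel_Rd d \<rightarrow>\<^sub>M prob_algebra (borel_Rd d) \<and>
     (\<forall>x\<in>Rd d. \<forall>g. has_gradient d F x g \<longrightarrow>
        (\<forall>i<d. has_bochner_integral (orc x) (\<lambda>v. v i) (g i)) \<and>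
        (\<integral>\<^sup>+v. ennreal ((vdist d v g)\<^sup>2) \<partial>orc x) \<le> ennreal (\<sigma>\<^sup>2))"

(* Law of the average of MK independent answers at the common point x, K from each machine. *)
definition minibatch_oracle ::
    "nat \<Rightarrow> nat \<Rightarrow> nat \<Rightarrow> (nat \<Rightarrow> vec \<Rightarrow> vec measure) \<Rightarrow> vec \<Rightarrow> vec measure" where
  "minibatch_oracle d M K orc x =
     distr (\<Pi>\<^sub>M q\<in>{..<M} \<times> {..<K}. orc (fst q) x) (borel_Rd d)
       (\<lambda>g i. (\<Sum>q\<in>{..<M} \<times> {..<K}. g q i) / (real M * real K))"

(* AC-SA as a Markov chain on the pairs (x_t, x^ag_t); G is the kernel of the stochastic
   gradients, and (b, c) = (beta_t, gamma_t). *)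
definition acsa_step ::
    "nat \<Rightarrow> (vec \<Rightarrow> vec measure) \<Rightarrow> real \<times> real \<Rightarrow> vec \<times> vec \<Rightarrow> (vec \<times> vec) measure" where
  "acsa_step d G = (\<lambda>(b, c) (x, xag).
     let xmd = (\<lambda>i. inverse b * x i + (1 - inverse b) * xag i)
     in distr (G xmd) (borel_Rd d \<Otimes>\<^sub>M borel_Rd d)
          (\<lambda>g. let x' = (\<lambda>i. x i - c * g i)
               in (x', \<lambda>i. inverse b * x' i + (1 - inverse b) * xag i)))"

fun acsa_iterate ::
    "nat \<Rightarrow> (vec \<Rightarrow> vec measure) \<Rightarrow> (real \<times> real) list \<Rightarrow> vec \<times> vec \<Rightarrow> (vec \<times> vec) measure" where
  "acsa_iterate d G [] s = return (borel_Rd d \<Otimes>\<^sub>M borel_Rd d) s"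
| "acsa_iterate d G (p # ps) s = bind (acsa_step d G p s) (acsa_iterate d G ps)"

definition acsa ::
    "nat \<Rightarrow> (vec \<Rightarrow> vec measure) \<Rightarrow> (real \<times> real) list \<Rightarrow> vec \<Rightarrow> vec measure" where
  "acsa d G ps x0 = distr (acsa_iterate d G ps (x0, x0)) (borel_Rd d) snd"

fun multistage_acsa ::
    "nat \<Rightarrow> (vec \<Rightarrow> vec measure) \<Rightarrow> (real \<times> real) list list \<Rightarrow> vec \<Rightarrow> vec measure" where
  "multistage_acsa d G [] x0 = return (borel_Rd d) x0"
| "multistage_acsa d G (s # ss) x0 = bind (acsa d G s x0) (multistage_acsa d G ss)"

(* One list of pairs (beta_t, gamma_t) per stage, T iterations in total. *)
definition stage_schedule :: "nat \<Rightarrow> (real \<times> real) list list \<Rightarrow> bool" where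
  "stage_schedule T stages \<longleftrightarrow> sum_list (map length stages) = T \<and>
     (\<forall>s\<in>set stages. \<forall>(b, c)\<in>set s. 1 \<le> b \<and> 0 \<le> c)"

definition minibatch_acsa ::
    "nat \<Rightarrow> nat \<Rightarrow> nat \<Rightarrow> (nat \<Rightarrow> vec \<Rightarrow> vec measure) \<Rightarrow> (real \<times> real) list list \<Rightarrow> vec measure" where
  "minibatch_acsa d M K orc stages =
     multistage_acsa d (minibatch_oracle d M K orc) stages (\<lambda>_. 0)"

end

(* Each stage has a length T and uses beta_t = (t + 2) / 2 and gamma_t = gamma (t + 1). The
   potential t (t + 1) (F(ag) - F u) + |x - u|^2 / gamma, with u the minimizer, grows in conditional
   expectation by at most 2 gamma (t + 1)^2 s2 per step, where s2 = sigma^2 / (M K) bounds the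
   minibatch variance. Together with |x - u|^2 <= (4 / l) (F x - F u) and gamma = 16 / (l T^2) this
   shows that a stage of length T >= 8 sqrt(H / l) maps an expected suboptimality e to at most
   e / 4 + 16 s2 / (l T). Stages of the shortest admissible length T0 contract the initial error
   exponentially down to the noise level s2 / (l T0); stages of doubling lengths then reduce it to
   the order of s2 / (l R). If R is of the order of T0, or if the noise s2 / (l R) exceeds Delta,
   staying at 0 is good enough. *)

theory Submission
  imports Defs
begin

text \<open>The step size of a stage depends on \<open>l\<close> and \<open>T\<close> alone. With
  \<gamma> = 16 / (l T^2) the initial distance costs at most (T^2 / 4) (F x - F u), which the final
  weight T (T + 1) turns into the factor 1/4; the condition 4 H \<gamma> \<le> 1 becomes 64 H \<le>
  l T^2. The accumulated noise is of order \<gamma> T^3 s2, so the stage lengths by themselves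
  control it. The schedule must be fixed before the dimension, the objective and the oracles. A list
  of stages is therefore described by an affine bound e -> q e + n valid from every starting point;
  such bounds compose and can be applied conditionally on a random start. Expectations of the
  suboptimality are nonnegative integrals until the end, so integrability of \<open>F\<close> at the
  output is a conclusion and not an obligation at every step. The inequalities for smooth strongly
  convex functions are derived from the definitions without integrating along segments, with
  slightly worse constants (l / 4 for l / 2, H for H / 2) that the universal constants
  absorb.\<close>

subsection \<open>Gradients and strong convexity\<close>

lemma vdist_nonneg: "0 \<le> vdist d x y"
  by (simp add: vdist_def vnorm_def)

lemma vdist_power2: "(vdist d x y)\<^sup>2 = (\<Sum>i<d. (x i - y i)\<^sup>2)"
  by (simp add: vdist_def vnorm_def L2_set_def sum_nonneg)

lemma vdist_commute: "vdist d x y = vdist d y x"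
  by (simp add: vdist_def vnorm_def L2_set_def power2_commute)

lemma abs_vinner_le: "\<bar>vinner d x y\<bar> \<le> vnorm d x * vnorm d y"
proof -
  have "\<bar>vinner d x y\<bar> \<le> (\<Sum>i<d. \<bar>x i\<bar> * \<bar>y i\<bar>)"
    unfolding vinner_def by (rule order_trans[OF sum_abs]) (simp add: abs_mult)
  then show ?thesis
    using L2_set_mult_ineq[of x y "{..<d}"] by (simp add: vnorm_def)
qed

lemma vinner_scale_right: "vinner d g (\<lambda>i. a * x i) = a * vinner d g x"
  by (simp add: vinner_def sum_distrib_left algebra_simps)

lemma Rd_affine: "x \<in> Rd d \<Longrightarrow> y \<in> Rd d \<Longrightarrow> (\<lambda>i. a * x i + b * y i) \<in> Rd d"
  by (simp add: Rd_def)

text \<open>The definition, applied at x + t (y - x) and compared with the linearization at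
  \<open>x\<close>, leaves an error small relative to t; dividing by t proves the claim up to
  \<open>e\<close>. Taking t at most 1/2 and bounding 1 - t below by 1/2 replaces the limit t -> 0,
  which is why the constant is l / 4 and not l / 2.\<close>

lemma strongly_convex_first_order:
  assumes sc: "strongly_convex d l F" and l: "0 \<le> l"
    and x: "x \<in> Rd d" and y: "y \<in> Rd d" and g: "has_gradient d F x g"
  shows "F x + vinner d g (\<lambda>i. y i - x i) + l / 4 * (vdist d y x)\<^sup>2 \<le> F y"
proof (rule field_le_epsilon)
  fix e :: real assume e: "0 < e"
  define n where "n = vdist d y x"
  define ip where "ip = vinner d g (\<lambda>i. y i - x i)"
  have n: "0 \<le> n" by (simp add: n_def vdist_nonneg)
  \<comment> \<open>With this tolerance the linearization error at distance \<open>t * n\<close> is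
    at most \<open>e * t\<close>; the summand 1 covers y = x, where n = 0.\<close>
  have "0 < e / (n + 1)" using e n by simp
  then obtain r where r: "r > 0"
    and lin: "\<And>z. z \<in> Rd d \<Longrightarrow> vdist d z x < r \<Longrightarrow>
      \<bar>F z - F x - vinner d g (\<lambda>i. z i - x i)\<bar> \<le> e / (n + 1) * vdist d z x"
    using g unfolding has_gradient_def by blast
  define t where "t = min (1/2) (r / (2 * (n + 1)))"
  have t: "0 < t" using r n by (simp add: t_def)
  have t2: "t \<le> 1/2" unfolding t_def by (rule min.cobounded1)
  have "t * n \<le> r / (2 * (n + 1)) * n"
    by (rule mult_right_mono) (auto simp: t_def n)
  also have "\<dots> < r"
    using r n by (simp add: field_simps add_nonneg_pos)
  finally have tn: "t * n < r" .
  define z where "z = (\<lambda>i. (1 - t) * x i + t * y i)"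
  have z: "z \<in> Rd d" using x y by (simp add: z_def Rd_def)
  have zx: "(\<lambda>i. z i - x i) = (\<lambda>i. t * (y i - x i))" by (auto simp: z_def algebra_simps)
  have dz: "vdist d z x = t * n"
    unfolding n_def vdist_def zx vnorm_def using t by (simp add: L2_set_right_distrib)
  have "F z \<le> (1 - t) * F x + t * F y - l / 2 * t * (1 - t) * n\<^sup>2"
    using sc x y t t2 unfolding strongly_convex_def z_def n_def vdist_commute[of d y x] by auto
  moreover have "F z - F x - t * ip \<ge> - (e / (n + 1) * (t * n))"
    using lin[OF z] tn by (auto simp: dz zx vinner_scale_right ip_def)
  moreover have "e / (n + 1) * (t * n) \<le> e * t"
    using e t n by (simp add: field_simps)
  moreover have "l / 4 * t * n\<^sup>2 \<le> l / 2 * t * (1 - t) * n\<^sup>2"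
  proof -
    have "l * t * n\<^sup>2 * (1/4) \<le> l * t * n\<^sup>2 * ((1 - t) / 2)"
      using t t2 l by (intro mult_left_mono) auto
    then show ?thesis by (simp add: mult_ac)
  qed
  ultimately have "t * (F x + ip + l / 4 * n\<^sup>2) \<le> t * (F y + e)"
    by (simp add: algebra_simps, argo)
  then show "F x + vinner d g (\<lambda>i. y i - x i) + l / 4 * (vdist d y x)\<^sup>2 \<le> F y + e"
    using t by (simp add: ip_def n_def)
qed

section \<open>Continuity of differentiable functions and existence of a minimizer\<close>

lemma continuous_vdist: "continuous_on A (\<lambda>y. vdist d y x)"
  unfolding vdist_def vnorm_def L2_set_def
  by (intro continuous_intros continuous_on_subset[OF continuous_on_product_coordinates]) auto

text \<open>Continuity refers to the product topology. There \<open>vdist\<close> is continuous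
  because it reads finitely many coordinates, and the gradient inequality with tolerance 1 bounds
  the change of \<open>F\<close> by a multiple of \<open>vdist\<close>.\<close>

lemma differentiable_imp_continuous:
  assumes "differentiable_Rd d F"
  shows "continuous_on (Rd d) F"
  unfolding continuous_on_def
proof
  fix x assume x: "x \<in> Rd d"
  obtain g where "has_gradient d F x g" using assms x by (auto simp: differentiable_Rd_def)
  then obtain r where r: "r > 0"
    and lin: "\<And>z. z \<in> Rd d \<Longrightarrow> vdist d z x < r \<Longrightarrow>
      \<bar>F z - F x - vinner d g (\<lambda>i. z i - x i)\<bar> \<le> 1 * vdist d z x"
    unfolding has_gradient_def using zero_less_one by blast
  have "((\<lambda>y. vdist d y x) \<longlongrightarrow> vdist d x x) (at x within Rd d)"
    using continuous_vdist[of "Rd d" d x] x by (auto simp: continuous_on_def)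
  then have lim: "((\<lambda>y. vdist d y x) \<longlongrightarrow> 0) (at x within Rd d)"
    by (simp add: vdist_def vnorm_def L2_set_def)
  have "\<forall>\<^sub>F y in at x within Rd d. norm (F y - F x) \<le> (vnorm d g + 1) * vdist d y x"
  proof -
    have "\<forall>\<^sub>F y in at x within Rd d. y \<in> Rd d" by (simp add: eventually_at_filter)
    then show ?thesis using order_tendstoD(2)[OF lim r]
    proof eventually_elim
      case (elim y)
      then show ?case
        using lin[of y] abs_vinner_le[of d g "\<lambda>i. y i - x i"]
        by (simp add: vdist_def algebra_simps)
    qed
  qed
  then show "(F \<longlongrightarrow> F x) (at x within Rd d)"
    by (subst Lim_null) (rule Lim_null_comparison[where g="\<lambda>y. (vnorm d g + 1) * vdist d y x"],
      auto intro!: tendsto_eq_intros lim)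
qed

text \<open>With \<open>g\<close> the gradient at 0, the first-order bound gives F x \<ge> F 0 - |g|
  |x| + (l / 4) |x|^2, which is at least F 0 as soon as |x| \<ge> 4 |g| / l. So a minimum over the
  cube of this half-width is a global one.\<close>

lemma strongly_convex_minimizer:
  assumes sc: "strongly_convex d l F" and l: "0 < l" and diff: "differentiable_Rd d F"
  obtains u where "u \<in> Rd d" "\<And>x. x \<in> Rd d \<Longrightarrow> F u \<le> F x"
proof -
  have zero: "(\<lambda>_. 0) \<in> Rd d" by (simp add: Rd_def)
  then obtain g where g: "has_gradient d F (\<lambda>_. 0) g" using diff by (auto simp: differentiable_Rd_def)
  define r where "r = 4 * vnorm d g / l"
  have r: "0 \<le> r" using l by (simp add: r_def vnorm_def)
  \<comment> \<open>Coordinates from \<open>d\<close> on are confined to 0, which keeps the cube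
    inside \<open>Rd d\<close>; as a product of compact sets it is compact in the product
    topology.\<close>
  define B where "B = PiE UNIV (\<lambda>i. if i < d then {-r..r} else {0::real})"
  have "compact B"
    using compactin_PiE[of "\<lambda>_. euclidean" UNIV "\<lambda>i. if i < d then {-r..r} else {0::real}"]
    unfolding B_def by (auto simp: euclidean_product_topology)
  have B0: "(\<lambda>_. 0) \<in> B" using r by (auto simp: B_def)
  have BR: "B \<subseteq> Rd d"
    by (auto simp: B_def Rd_def PiE_iff split: if_splits)
  obtain u where u: "u \<in> B" and min: "\<And>x. x \<in> B \<Longrightarrow> F u \<le> F x"
    using continuous_attains_inf[OF \<open>compact B\<close>, of F] B0
      continuous_on_subset[OF differentiable_imp_continuous[OF diff] BR] by blast
  have "F u \<le> F x" if x: "x \<in> Rd d" for x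
  proof (cases "x \<in> B")
    case False
    then obtain i where i: "x i \<notin> (if i < d then {-r..r} else {0})"
      by (auto simp: B_def PiE_iff)
    then have i: "i < d" "r < \<bar>x i\<bar>"
      using x by (auto simp: Rd_def split: if_splits)
    have "\<bar>x i\<bar> \<le> vnorm d x"
      unfolding vnorm_def using member_le_L2_set[of "{..<d}" i "\<lambda>i. \<bar>x i\<bar>"] i
      by (simp add: L2_set_def)
    then have big: "r < vnorm d x" using i by simp
    have "F (\<lambda>_. 0) + vinner d g x + l / 4 * (vnorm d x)\<^sup>2 \<le> F x"
      using strongly_convex_first_order[OF sc _ zero x g] l by (simp add: vdist_def)
    moreover have "- (vnorm d g * vnorm d x) \<le> vinner d g x"
      using abs_vinner_le[of d g x] by simp
    moreover have "vnorm d g * vnorm d x \<le> l / 4 * (vnorm d x)\<^sup>2"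
    proof -
      have "vnorm d g \<le> l / 4 * vnorm d x" using big l by (simp add: r_def field_simps)
      then show ?thesis using mult_right_mono[of "vnorm d g" "l / 4 * vnorm d x" "vnorm d x"] big r
        by (simp add: power2_eq_square)
    qed
    ultimately have "F (\<lambda>_. 0) \<le> F x" by linarith
    then show ?thesis using min[OF B0] by simp
  qed (rule min)
  then show ?thesis using that u BR by blast
qed

text \<open>For a small step t along the difference \<open>k\<close>, the two linearizations give t
  |k|^2 \<le> 2 a t |k| for every tolerance \<open>a\<close>. The lemma serves to identify the
  gradient map of \<open>smooth\<close> with the average of the component gradients.\<close>

lemma has_gradient_unique:
  assumes x: "x \<in> Rd d" and g: "has_gradient d F x g" and h: "has_gradient d F x h"
  shows "g = h"
proof -
  have gR: "g \<in> Rd d" and hR: "h \<in> Rd d" using g h by (auto simp: has_gradient_def)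
  define k where "k = (\<lambda>i. g i - h i)"
  have "(vnorm d k)\<^sup>2 \<le> 0"
  proof (rule field_le_epsilon)
    fix e :: real assume e: "0 < e"
    define n where "n = vnorm d k"
    have n: "0 \<le> n" by (simp add: n_def vnorm_def)
    define a where "a = e / (2 * (n + 1))"
    have a: "0 < a" using e n by (simp add: a_def)
    obtain r where r: "r > 0"
      and lin1: "\<And>z. z \<in> Rd d \<Longrightarrow> vdist d z x < r \<Longrightarrow>
        \<bar>F z - F x - vinner d g (\<lambda>i. z i - x i)\<bar> \<le> a * vdist d z x"
      using g a unfolding has_gradient_def by blast
    obtain s where s: "s > 0"
      and lin2: "\<And>z. z \<in> Rd d \<Longrightarrow> vdist d z x < s \<Longrightarrow>
        \<bar>F z - F x - vinner d h (\<lambda>i. z i - x i)\<bar> \<le> a * vdist d z x"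
      using h a unfolding has_gradient_def by blast
    define t where "t = min r s / (n + 1)"
    have t: "0 < t" using r s n by (simp add: t_def)
    have "t * n < t * (n + 1)" using t by simp
    also have "\<dots> = min r s" using n by (simp add: t_def)
    finally have tn: "t * n < r" "t * n < s" by auto
    define z where "z = (\<lambda>i. x i + t * k i)"
    have z: "z \<in> Rd d" using x gR hR by (simp add: z_def k_def Rd_def)
    have zx: "(\<lambda>i. z i - x i) = (\<lambda>i. t * k i)" by (auto simp: z_def)
    have dz: "vdist d z x = t * n"
      unfolding n_def vdist_def zx vnorm_def using t by (simp add: L2_set_right_distrib)
    have "t * vinner d g k - t * vinner d h k \<le> 2 * (a * (t * n))"
      using lin1[OF z] lin2[OF z] tn unfolding zx vinner_scale_right dz by linarith
    moreover have "vinner d g k - vinner d h k = (vnorm d k)\<^sup>2"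
    proof -
      have "(vnorm d k)\<^sup>2 = (\<Sum>i<d. (k i)\<^sup>2)"
        by (simp add: vnorm_def L2_set_def sum_nonneg)
      then show ?thesis
        by (simp add: vinner_def k_def sum_subtractf[symmetric] power2_eq_square algebra_simps)
    qed
    ultimately have "t * (vnorm d k)\<^sup>2 \<le> t * (2 * a * n)"
      by (simp add: algebra_simps)
    then have "(vnorm d k)\<^sup>2 \<le> 2 * a * n" using t by simp
    also have "\<dots> \<le> e" using e n by (simp add: a_def field_simps)
    finally show "(vnorm d k)\<^sup>2 \<le> 0 + e" by simp
  qed
  then have "\<forall>i<d. k i = 0"
    using L2_set_eq_0_iff[of "{..<d}" k] by (simp add: vnorm_def)
  then show ?thesis using gR hR by (auto simp: k_def Rd_def fun_eq_iff) (metis not_le)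
qed

lemma has_gradient_average:
  assumes "\<And>m. m < M \<Longrightarrow> has_gradient d (Fs m) x (g m)"
  shows "has_gradient d (average_objective M Fs) x (\<lambda>i. (\<Sum>m<M. g m i) / real M)"
  unfolding has_gradient_def
proof (intro conjI allI impI)
  show "(\<lambda>i. (\<Sum>m<M. g m i) / real M) \<in> Rd d"
    using assms by (auto simp: Rd_def has_gradient_def)
  fix e :: real assume e: "0 < e"
  have "\<forall>m\<in>{..<M}. \<exists>r>0. \<forall>y\<in>Rd d. vdist d y x < r \<longrightarrow>
      \<bar>Fs m y - Fs m x - vinner d (g m) (\<lambda>i. y i - x i)\<bar> \<le> e * vdist d y x"
    using assms e unfolding has_gradient_def by auto
  then obtain r where r: "\<And>m. m < M \<Longrightarrow> 0 < r m"
    and lin: "\<And>m y. m < M \<Longrightarrow> y \<in> Rd d \<Longrightarrow> vdist d y x < r m \<Longrightarrow>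
      \<bar>Fs m y - Fs m x - vinner d (g m) (\<lambda>i. y i - x i)\<bar> \<le> e * vdist d y x"
    by (metis lessThan_iff)
  \<comment> \<open>The extra element 1 makes the minimum meaningful for M = 0; the average is then
    0 by the convention x / 0 = 0, and the estimate is trivial.\<close>
  define \<rho> where "\<rho> = Min (insert 1 (r ` {..<M}))"
  have "\<rho> > 0" using r by (auto simp: \<rho>_def)
  moreover have "\<bar>average_objective M Fs y - average_objective M Fs x -
      vinner d (\<lambda>i. (\<Sum>m<M. g m i) / real M) (\<lambda>i. y i - x i)\<bar> \<le> e * vdist d y x"
    if y: "y \<in> Rd d" "vdist d y x < \<rho>" for y
  proof -
    have inn: "vinner d (\<lambda>i. (\<Sum>m<M. g m i) / real M) (\<lambda>i. y i - x i)
        = (\<Sum>m<M. vinner d (g m) (\<lambda>i. y i - x i)) / real M"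
      unfolding vinner_def by (subst sum.swap) (simp add: sum_divide_distrib sum_distrib_right)
    have "\<bar>\<Sum>m<M. (Fs m y - Fs m x - vinner d (g m) (\<lambda>i. y i - x i))\<bar>
        \<le> (\<Sum>m<M. e * vdist d y x)"
    proof (rule order_trans[OF sum_abs sum_mono])
      fix m assume m: "m \<in> {..<M}"
      then have "\<rho> \<le> r m" by (auto simp: \<rho>_def)
      then show "\<bar>Fs m y - Fs m x - vinner d (g m) (\<lambda>i. y i - x i)\<bar> \<le> e * vdist d y x"
        using lin m y by auto
    qed
    then have "\<bar>\<Sum>m<M. (Fs m y - Fs m x - vinner d (g m) (\<lambda>i. y i - x i))\<bar> / real M
        \<le> e * vdist d y x"
      using e by (cases "M = 0") (auto simp: field_simps vdist_nonneg)
    moreover have "average_objective M Fs y - average_objective M Fs x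
        - vinner d (\<lambda>i. (\<Sum>m<M. g m i) / real M) (\<lambda>i. y i - x i)
      = (\<Sum>m<M. (Fs m y - Fs m x - vinner d (g m) (\<lambda>i. y i - x i))) / real M"
      unfolding inn average_objective_def by (simp add: sum_subtractf diff_divide_distrib)
    ultimately show ?thesis by simp
  qed
  ultimately show "\<exists>r>0. \<forall>y\<in>Rd d. vdist d y x < r \<longrightarrow>
      \<bar>average_objective M Fs y - average_objective M Fs x -
       vinner d (\<lambda>i. (\<Sum>m<M. g m i) / real M) (\<lambda>i. y i - x i)\<bar> \<le> e * vdist d y x"
    by blast
qed

subsection \<open>One step of AC-SA\<close>

text \<open>The gradient map and the minimizer are fixed as data, so that the analysis sees the
  average objective only; the components return when the minibatch oracle is shown to fit this
  setting.\<close>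

locale strongly_convex_objective =
  fixes d :: nat and l H :: real and F :: "vec \<Rightarrow> real" and G :: "vec \<Rightarrow> vec" and u :: vec
  assumes l_pos: "0 < l" and H_pos: "0 < H"
    and convex: "strongly_convex d l F"
    and gradient: "x \<in> Rd d \<Longrightarrow> has_gradient d F x (G x)"
    and lipschitz: "x \<in> Rd d \<Longrightarrow> y \<in> Rd d \<Longrightarrow> vdist d (G x) (G y) \<le> H * vdist d x y"
    and u_Rd: "u \<in> Rd d"
    and u_min: "x \<in> Rd d \<Longrightarrow> F u \<le> F x"
begin

lemma gradient_Rd: "x \<in> Rd d \<Longrightarrow> G x \<in> Rd d"
  using gradient by (auto simp: has_gradient_def)

lemma F_continuous: "continuous_on (Rd d) F"
  using gradient by (intro differentiable_imp_continuous) (auto simp: differentiable_Rd_def)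

lemma first_order:
  assumes "x \<in> Rd d" "y \<in> Rd d"
  shows "F x + vinner d (G x) (\<lambda>i. y i - x i) \<le> F y"
proof -
  have "0 \<le> l / 4 * (vdist d y x)\<^sup>2" using l_pos by simp
  then show ?thesis
    using strongly_convex_first_order[OF convex _ assms gradient[OF assms(1)]] l_pos by linarith
qed

text \<open>Convexity at \<open>y\<close> gives the descent inequality without integrating along the segment,
  at the price of the constant \<open>H\<close> in place of \<open>H / 2\<close>.\<close>
lemma descent:
  assumes x: "x \<in> Rd d" and y: "y \<in> Rd d"
  shows "F y \<le> F x + vinner d (G x) (\<lambda>i. y i - x i) + H * (vdist d y x)\<^sup>2"
proof -
  have "vinner d (\<lambda>i. G y i - G x i) (\<lambda>i. y i - x i) \<le> vdist d (G y) (G x) * vdist d y x"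
    using abs_vinner_le[of d "\<lambda>i. G y i - G x i" "\<lambda>i. y i - x i"] by (simp add: vdist_def)
  also have "\<dots> \<le> H * vdist d y x * vdist d y x"
    by (intro mult_right_mono lipschitz x y vdist_nonneg)
  finally have "vinner d (\<lambda>i. G y i - G x i) (\<lambda>i. y i - x i) \<le> H * (vdist d y x)\<^sup>2"
    by (simp add: power2_eq_square mult.assoc)
  moreover have "F y + vinner d (G y) (\<lambda>i. x i - y i) \<le> F x"
    by (rule first_order[OF y x])
  moreover have "vinner d (\<lambda>i. G y i - G x i) (\<lambda>i. y i - x i) + vinner d (G y) (\<lambda>i. x i - y i)
      = - vinner d (G x) (\<lambda>i. y i - x i)"
    unfolding vinner_def sum_negf[symmetric] sum.distrib[symmetric]
    by (intro sum.cong) (auto simp: algebra_simps)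
  ultimately show ?thesis by linarith
qed

text \<open>Strong convexity at the midpoint of \<open>x\<close> and \<open>u\<close>, whose value
  is at least \<open>F u\<close>. This converts the suboptimality reached by one stage into the
  initial distance of the next.\<close>

lemma vdist_minimizer_le:
  assumes x: "x \<in> Rd d"
  shows "(vdist d x u)\<^sup>2 \<le> 4 / l * (F x - F u)"
proof -
  have "F (\<lambda>i. (1 - 1/2) * x i + 1/2 * u i)
      \<le> (1 - 1/2) * F x + 1/2 * F u - l / 2 * (1/2) * (1 - 1/2) * (vdist d x u)\<^sup>2"
    using bspec[OF bspec[OF bspec[OF convex[unfolded strongly_convex_def] x] u_Rd], of "1/2"]
    by simp
  moreover have "F u \<le> F (\<lambda>i. (1 - 1/2) * x i + 1/2 * u i)"
    by (intro u_min Rd_affine x u_Rd)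
  ultimately have "l * (vdist d x u)\<^sup>2 \<le> 4 * (F x - F u)" by simp
  then show ?thesis using l_pos by (simp add: field_simps)
qed

text \<open>Here \<theta> is 1 / beta and \<open>c\<close> is gamma. The inequality is deterministic
  and keeps the noise g - G md explicit: a linear term whose coefficient does not involve
  \<open>g\<close>, hence of mean zero, and a square. The weight \<open>p\<close> with \<theta> = 2
  c p gives the cross term of |x' - u|^2 exactly the coefficient \<theta> of the linearization at
  \<open>u\<close>.\<close>

lemma acsa_step_pointwise:
  assumes x: "x \<in> Rd d" and a: "a \<in> Rd d" and g: "g \<in> Rd d"
    and th: "0 < \<theta>" "\<theta> \<le> 1" and c: "0 \<le> c" "H * \<theta> * c \<le> 1 / 2" and p: "\<theta> = 2 * c * p"
    and md: "md = (\<lambda>i. \<theta> * x i + (1 - \<theta>) * a i)"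
    and x': "x' = (\<lambda>i. x i - c * g i)"
    and a': "a' = (\<lambda>i. \<theta> * x' i + (1 - \<theta>) * a i)"
  shows "F a' - F u + p * (vdist d x' u)\<^sup>2 \<le>
    (1 - \<theta>) * (F a - F u) + p * (vdist d x u)\<^sup>2
    + vinner d (\<lambda>i. \<theta> * (c * G md i - (x i - u i))) (\<lambda>i. g i - G md i)
    + \<theta> * c * (vdist d g (G md))\<^sup>2"
proof -
  have mdR: "md \<in> Rd d" unfolding md by (intro Rd_affine x a)
  have x'R: "x' \<in> Rd d" using x g by (simp add: x' Rd_def)
  have a'R: "a' \<in> Rd d" unfolding a' by (intro Rd_affine x'R a)
  \<comment> \<open>\<open>md\<close> and \<open>a'\<close> are the same combination of
    \<open>a\<close> with \<open>x\<close> and with \<open>x'\<close>, so the move from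
    \<open>md\<close> to \<open>a'\<close> is the gradient step scaled by \<theta>.\<close>
  have a'md: "(\<lambda>i. a' i - md i) = (\<lambda>i. - (\<theta> * c) * g i)"
    by (auto simp: a' md x' algebra_simps)
  define n where "n = (\<Sum>i<d. (g i)\<^sup>2)"
  have n: "0 \<le> n" by (simp add: n_def sum_nonneg)
  have d1: "(vdist d a' md)\<^sup>2 = (\<theta> * c)\<^sup>2 * n"
    unfolding vdist_power2 using fun_cong[OF a'md]
    by (simp add: n_def power_mult_distrib sum_distrib_left)
  have "F a' \<le> F md + vinner d (G md) (\<lambda>i. a' i - md i) + H * (vdist d a' md)\<^sup>2"
    by (rule descent[OF mdR a'R])
  then have 1: "F a' \<le> F md - \<theta> * c * vinner d (G md) g + H * (\<theta> * c)\<^sup>2 * n"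
    unfolding a'md vinner_scale_right d1 by (simp add: mult.assoc)
  \<comment> \<open>Lower linearizations at \<open>md\<close>, evaluated at \<open>a\<close> and
    \<open>u\<close> with weights 1 - \<theta> and \<theta>; by the choice of \<open>md\<close> the
    weighted displacements add up to - \<theta> (x - u).\<close>
  have "(1 - \<theta>) * (F md + vinner d (G md) (\<lambda>i. a i - md i)) \<le> (1 - \<theta>) * F a"
    using th by (intro mult_left_mono first_order mdR a) auto
  moreover have "\<theta> * (F md + vinner d (G md) (\<lambda>i. u i - md i)) \<le> \<theta> * F u"
    using th by (intro mult_left_mono first_order mdR u_Rd) auto
  moreover have "(1 - \<theta>) * vinner d (G md) (\<lambda>i. a i - md i) + \<theta> * vinner d (G md) (\<lambda>i. u i - md i)
      = - \<theta> * vinner d (G md) (\<lambda>i. x i - u i)"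
    unfolding vinner_def sum_distrib_left sum.distrib[symmetric]
    by (intro sum.cong) (auto simp: md algebra_simps)
  ultimately have 2: "F md \<le> (1 - \<theta>) * F a + \<theta> * F u + \<theta> * vinner d (G md) (\<lambda>i. x i - u i)"
    by (simp add: algebra_simps)
  have "(vdist d x' u)\<^sup>2 = (vdist d x u)\<^sup>2 - 2 * c * vinner d g (\<lambda>i. x i - u i) + c\<^sup>2 * n"
    unfolding vdist_power2 n_def vinner_def sum_distrib_left sum_subtractf[symmetric]
      sum.distrib[symmetric]
    by (intro sum.cong) (auto simp: x' power2_eq_square algebra_simps)
  then have 3: "p * (vdist d x' u)\<^sup>2
      = p * (vdist d x u)\<^sup>2 - \<theta> * vinner d g (\<lambda>i. x i - u i) + \<theta> * c / 2 * n"
    unfolding p by (simp only:) (simp add: algebra_simps power2_eq_square)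
  \<comment> \<open>Two multiples of |g|^2 arise, one from smoothness and one from the squared
    distance; the step-size condition bounds their sum by \<theta> c |g|^2.\<close>
  have "(\<theta> * c * n) * (H * \<theta> * c) \<le> (\<theta> * c * n) * (1 / 2)"
    using th c n by (intro mult_left_mono) auto
  then have 4: "H * (\<theta> * c)\<^sup>2 * n + \<theta> * c / 2 * n \<le> \<theta> * c * n"
    by (simp add: power2_eq_square algebra_simps)
  \<comment> \<open>With \<open>g\<close> written as \<open>G md\<close> plus noise, the terms in |G
    md|^2 cancel, so an exact gradient leaves no error at all.\<close>
  have 5: "\<theta> * vinner d (G md) (\<lambda>i. x i - u i) - \<theta> * c * vinner d (G md) g
      - \<theta> * vinner d g (\<lambda>i. x i - u i) + \<theta> * c * n
    = vinner d (\<lambda>i. \<theta> * (c * G md i - (x i - u i))) (\<lambda>i. g i - G md i)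
      + \<theta> * c * (vdist d g (G md))\<^sup>2"
    unfolding vdist_power2 n_def vinner_def sum_distrib_left sum_subtractf[symmetric]
      sum.distrib[symmetric]
    by (intro sum.cong) (auto simp: power2_eq_square algebra_simps)
  show ?thesis using 1 2 3 4 5 by (simp add: algebra_simps)
qed

end

section \<open>Measurability of the AC-SA kernels\<close>

lemma space_borel_Rd [simp]: "space (borel_Rd d) = Rd d"
  by (simp add: borel_Rd_def space_restrict_space)

lemma measurable_borel_Rd_coordinate [measurable]: "(\<lambda>v. v i) \<in> borel_measurable (borel_Rd d)"
  unfolding borel_Rd_def by (intro measurable_restrict_space1) measurable

text \<open>The Borel sets of a countable product are generated by the coordinates, so measurability
  can be tested one coordinate at a time.\<close>

lemma measurable_borel_RdI:
  assumes "\<And>w. w \<in> space N \<Longrightarrow> f w \<in> Rd d" "\<And>i. (\<lambda>w. f w i) \<in> borel_measurable N"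
  shows "f \<in> N \<rightarrow>\<^sub>M borel_Rd d"
  unfolding borel_Rd_def
  using assms by (intro measurable_restrict_space2 measurable_coordinatewise_then_product) auto

lemma measurable_coordinate_comp:
  "f \<in> N \<rightarrow>\<^sub>M borel_Rd d \<Longrightarrow> (\<lambda>w. f w i) \<in> borel_measurable N"
  by (rule measurable_compose[OF _ measurable_borel_Rd_coordinate])

lemma borel_measurable_vdist:
  assumes "f \<in> N \<rightarrow>\<^sub>M borel_Rd d" "g \<in> N \<rightarrow>\<^sub>M borel_Rd d"
  shows "(\<lambda>w. vdist d (f w) (g w)) \<in> borel_measurable N"
proof -
  have [measurable]: "(\<lambda>w. f w i) \<in> borel_measurable N" "(\<lambda>w. g w i) \<in> borel_measurable N" for i
    using assms by (auto intro: measurable_coordinate_comp)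
  show ?thesis unfolding vdist_def vnorm_def L2_set_def by measurable
qed

text \<open>The state enters twice, through the query point and through the map applied to the
  answer. The pushforward rule for kernels therefore asks for joint measurability of that map in
  state and answer, supplied by \<open>x'\<close> and \<open>ag\<close>.\<close>

lemma measurable_acsa_step:
  assumes Q: "Q \<in> borel_Rd d \<rightarrow>\<^sub>M prob_algebra (borel_Rd d)"
  shows "acsa_step d Q p \<in> borel_Rd d \<Otimes>\<^sub>M borel_Rd d \<rightarrow>\<^sub>M prob_algebra (borel_Rd d \<Otimes>\<^sub>M borel_Rd d)"
proof -
  obtain b c where p: "p = (b, c)" by force
  let ?S = "borel_Rd d"
  let ?md = "\<lambda>s. (\<lambda>i. inverse b * fst s i + (1 - inverse b) * snd s i)"
  let ?x' = "\<lambda>s g. (\<lambda>i. fst s i - c * g i)"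
  have md: "?md \<in> ?S \<Otimes>\<^sub>M ?S \<rightarrow>\<^sub>M ?S"
    by (rule measurable_borel_RdI)
      (auto simp: space_pair_measure Rd_def intro!: borel_measurable_add borel_measurable_times
        measurable_compose[OF _ measurable_borel_Rd_coordinate])
  have x': "(\<lambda>w. ?x' (fst w) (snd w)) \<in> (?S \<Otimes>\<^sub>M ?S) \<Otimes>\<^sub>M ?S \<rightarrow>\<^sub>M ?S"
    by (rule measurable_borel_RdI)
      (auto simp: space_pair_measure Rd_def intro!: borel_measurable_diff borel_measurable_times
        measurable_compose[OF _ measurable_borel_Rd_coordinate])
  have ag: "(\<lambda>w. (\<lambda>i. inverse b * ?x' (fst w) (snd w) i + (1 - inverse b) * snd (fst w) i))
      \<in> (?S \<Otimes>\<^sub>M ?S) \<Otimes>\<^sub>M ?S \<rightarrow>\<^sub>M ?S"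
    by (rule measurable_borel_RdI)
      (auto simp: space_pair_measure Rd_def intro!: borel_measurable_diff borel_measurable_add
        borel_measurable_times measurable_compose[OF _ measurable_borel_Rd_coordinate])
  have "(\<lambda>s. distr (Q (?md s)) (?S \<Otimes>\<^sub>M ?S)
      (\<lambda>g. (?x' s g, \<lambda>i. inverse b * ?x' s g i + (1 - inverse b) * snd s i)))
    \<in> ?S \<Otimes>\<^sub>M ?S \<rightarrow>\<^sub>M prob_algebra (?S \<Otimes>\<^sub>M ?S)"
    using x' ag
    by (intro measurable_distr_prob_space2[where M="?S"] measurable_compose[OF md Q])
      (simp add: split_beta' measurable_Pair)
  then show ?thesis
    by (simp add: acsa_step_def p split_beta' Let_def)
qed

lemma measurable_acsa_iterate:
  assumes Q: "Q \<in> borel_Rd d \<rightarrow>\<^sub>M prob_algebra (borel_Rd d)"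
  shows "acsa_iterate d Q ps
    \<in> borel_Rd d \<Otimes>\<^sub>M borel_Rd d \<rightarrow>\<^sub>M prob_algebra (borel_Rd d \<Otimes>\<^sub>M borel_Rd d)"
proof (induction ps)
  case Nil
  then show ?case by (simp add: measurable_return_prob_space cong: measurable_cong)
next
  case (Cons p ps)
  then show ?case
    using measurable_bind_prob_space[OF measurable_acsa_step[OF Q, of p] Cons] by simp
qed

lemma measurable_acsa:
  assumes Q: "Q \<in> borel_Rd d \<rightarrow>\<^sub>M prob_algebra (borel_Rd d)"
  shows "acsa d Q ps \<in> borel_Rd d \<rightarrow>\<^sub>M prob_algebra (borel_Rd d)"
proof -
  have "(\<lambda>x. acsa_iterate d Q ps (x, x)) \<in> borel_Rd d \<rightarrow>\<^sub>M prob_algebra (borel_Rd d \<Otimes>\<^sub>M borel_Rd d)"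
    by (rule measurable_compose[OF _ measurable_acsa_iterate[OF Q]]) measurable
  then have "(\<lambda>x. distr (acsa_iterate d Q ps (x, x)) (borel_Rd d) snd)
      \<in> borel_Rd d \<rightarrow>\<^sub>M prob_algebra (borel_Rd d)"
    by (rule measurable_distr_prob_space2) measurable
  then show ?thesis by (simp add: acsa_def cong: measurable_cong)
qed

lemma measurable_multistage_acsa:
  assumes Q: "Q \<in> borel_Rd d \<rightarrow>\<^sub>M prob_algebra (borel_Rd d)"
  shows "multistage_acsa d Q ss \<in> borel_Rd d \<rightarrow>\<^sub>M prob_algebra (borel_Rd d)"
proof (induction ss)
  case Nil
  then show ?case by (simp add: measurable_return_prob_space cong: measurable_cong)
next
  case (Cons s ss)
  then show ?case
    using measurable_bind_prob_space[OF measurable_acsa[OF Q, of s] Cons] by simp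
qed

subsection \<open>Expected progress within a stage\<close>

text \<open>The starting index makes the tail of a stage a list of the same form, although the
  parameters depend on the absolute position; the induction along a stage relies on this.\<close>

definition stage_params :: "real \<Rightarrow> nat \<Rightarrow> nat \<Rightarrow> (real \<times> real) list" where
  "stage_params \<gamma> t T = map (\<lambda>j. ((real j + 2) / 2, \<gamma> * (real j + 1))) [t..<T]"

definition stage :: "real \<Rightarrow> nat \<Rightarrow> (real \<times> real) list" where
  "stage l T = stage_params (16 / (l * (real T)\<^sup>2)) 0 T"

text \<open>What the analysis retains of the minibatch oracle; \<open>s2\<close> bounds the variance
  of an averaged answer. The mean is prescribed on the coordinates below \<open>d\<close>, the
  others being 0 on \<open>Rd d\<close>.\<close>

locale stochastic_gradient = strongly_convex_objective +
  fixes Q :: "vec \<Rightarrow> vec measure" and s2 :: real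
  assumes kernel: "Q \<in> borel_Rd d \<rightarrow>\<^sub>M prob_algebra (borel_Rd d)"
    and s2_nonneg: "0 \<le> s2"
    and mean: "x \<in> Rd d \<Longrightarrow> i < d \<Longrightarrow> has_bochner_integral (Q x) (\<lambda>v. v i) (G x i)"
    and variance: "x \<in> Rd d \<Longrightarrow> (\<integral>\<^sup>+v. ennreal ((vdist d v (G x))\<^sup>2) \<partial>Q x) \<le> ennreal s2"
begin

lemma
  assumes "x \<in> Rd d"
  shows prob_space_Q: "prob_space (Q x)" and sets_Q: "sets (Q x) = sets (borel_Rd d)"
  using measurable_space[OF kernel, of x] assms by (auto simp: space_prob_algebra)

lemma space_Q: "x \<in> Rd d \<Longrightarrow> space (Q x) = Rd d"
  using sets_eq_imp_space_eq[OF sets_Q] by simp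

lemma F_measurable: "F \<in> borel_measurable (borel_Rd d)"
  unfolding borel_Rd_def by (rule borel_measurable_continuous_on_restrict[OF F_continuous])

text \<open>The passage from pointwise inequalities to expectations. Nonnegativity of \<Psi> forces
  the dominating quadratic to be nonnegative, so its nonnegative integral is a Bochner integral, in
  which the term linear in the noise vanishes.\<close>

lemma nn_integral_le_quadratic:
  assumes x: "x \<in> Rd d"
    and nonneg: "\<And>g. g \<in> Rd d \<Longrightarrow> 0 \<le> \<Psi> g"
    and le: "\<And>g. g \<in> Rd d \<Longrightarrow> \<Psi> g \<le> A + vinner d w (\<lambda>i. g i - G x i) + B * (vdist d g (G x))\<^sup>2"
    and B: "0 \<le> B"
  shows "(\<integral>\<^sup>+g. ennreal (\<Psi> g) \<partial>Q x) \<le> ennreal (A + B * s2)"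
proof -
  interpret prob_space "Q x" by (rule prob_space_Q[OF x])
  let ?R = "\<lambda>g. A + vinner d w (\<lambda>i. g i - G x i) + B * (vdist d g (G x))\<^sup>2"
  have "(\<lambda>v. v) \<in> Q x \<rightarrow>\<^sub>M borel_Rd d"
    by (rule measurable_ident_sets[OF sets_Q[OF x]])
  then have "(\<lambda>v. vdist d v (G x)) \<in> borel_measurable (Q x)"
    using gradient_Rd[OF x] by (intro borel_measurable_vdist) auto
  then have int2: "integrable (Q x) (\<lambda>v. (vdist d v (G x))\<^sup>2)"
    using variance[OF x] by (intro integrableI_nonneg) (auto intro: le_less_trans)
  have V: "(\<integral>v. (vdist d v (G x))\<^sup>2 \<partial>Q x) \<le> s2"
    using variance[OF x] s2_nonneg by (subst (asm) nn_integral_eq_integral[OF int2]) auto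
  have "has_bochner_integral (Q x) (\<lambda>g. \<Sum>i<d. w i * (g i - G x i)) (\<Sum>i<d. w i * (G x i - G x i))"
    using mean[OF x] prob_space
    by (intro has_bochner_integral_sum has_bochner_integral_mult_right has_bochner_integral_diff)
      (auto simp: has_bochner_integral_iff)
  then have lin: "has_bochner_integral (Q x) (\<lambda>g. vinner d w (\<lambda>i. g i - G x i)) 0"
    by (simp add: vinner_def)
  have intR: "integrable (Q x) ?R"
    using lin int2 by (auto simp: has_bochner_integral_iff)
  have "(\<integral>\<^sup>+g. ennreal (\<Psi> g) \<partial>Q x) \<le> (\<integral>\<^sup>+g. ennreal (?R g) \<partial>Q x)"
    using le by (intro nn_integral_mono ennreal_leI) (simp add: space_Q[OF x])
  also have "\<dots> = ennreal (\<integral>g. ?R g \<partial>Q x)"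
    using le nonneg by (intro nn_integral_eq_integral intR AE_I2)
      (auto simp: space_Q[OF x] intro: order_trans)
  also have "(\<integral>g. ?R g \<partial>Q x) = A + B * (\<integral>v. (vdist d v (G x))\<^sup>2 \<partial>Q x)"
    using lin int2 prob_space by (simp add: has_bochner_integral_iff)
  also have "ennreal \<dots> \<le> ennreal (A + B * s2)"
    using V B by (intro ennreal_leI add_left_mono mult_left_mono)
  finally show ?thesis .
qed

text \<open>The weight vanishes at t = 0, so at the start of a stage only the distance counts, and
  it reaches T (T + 1), by which the final value is normalized.\<close>

definition potential :: "real \<Rightarrow> nat \<Rightarrow> vec \<times> vec \<Rightarrow> real" where
  "potential \<gamma> t s = real t * (real t + 1) * (F (snd s) - F u) + (vdist d (fst s) u)\<^sup>2 / \<gamma>"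

lemma potential_nonneg: "0 < \<gamma> \<Longrightarrow> s \<in> Rd d \<times> Rd d \<Longrightarrow> 0 \<le> potential \<gamma> t s"
  unfolding potential_def using u_min[of "snd s"] by (auto simp: mem_Times_iff)

lemma potential_measurable: "potential \<gamma> t \<in> borel_measurable (borel_Rd d \<Otimes>\<^sub>M borel_Rd d)"
proof -
  have [measurable]: "(\<lambda>s. F (snd s)) \<in> borel_measurable (borel_Rd d \<Otimes>\<^sub>M borel_Rd d)"
    by (rule measurable_compose[OF measurable_snd F_measurable])
  have [measurable]: "(\<lambda>s. vdist d (fst s) u) \<in> borel_measurable (borel_Rd d \<Otimes>\<^sub>M borel_Rd d)"
    using u_Rd by (intro borel_measurable_vdist) auto
  show ?thesis unfolding potential_def by measurable
qed

text \<open>The pointwise inequality with \<theta> = 2 / (t + 2), multiplied by k = (t + 1) (t + 2):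
  then k (1 - \<theta>) = t (t + 1) is the previous weight, k p = 1 / \<gamma> does not depend on t,
  and k \<theta> c = 2 \<gamma> (t + 1)^2 multiplies the variance.\<close>

lemma potential_step:
  assumes \<gamma>: "0 < \<gamma>" "4 * H * \<gamma> \<le> 1" and s: "s \<in> Rd d \<times> Rd d"
  shows "(\<integral>\<^sup>+s'. ennreal (potential \<gamma> (Suc t) s')
      \<partial>acsa_step d Q ((real t + 2) / 2, \<gamma> * (real t + 1)) s)
    \<le> ennreal (potential \<gamma> t s + 2 * \<gamma> * (real t + 1)\<^sup>2 * s2)"
proof -
  obtain x a where s_def: "s = (x, a)" and x: "x \<in> Rd d" and a: "a \<in> Rd d" using s by auto
  define \<theta> where "\<theta> = 2 / (real t + 2)"
  define c where "c = \<gamma> * (real t + 1)"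
  define md where "md = (\<lambda>i. \<theta> * x i + (1 - \<theta>) * a i)"
  define x' where "x' = (\<lambda>g i. x i - c * g i)"
  define a' where "a' = (\<lambda>g i. \<theta> * x' g i + (1 - \<theta>) * a i)"
  define k where "k = (real t + 1) * (real t + 2)"
  have mdR: "md \<in> Rd d" unfolding md_def by (intro Rd_affine x a)
  have x'R: "x' g \<in> Rd d" if "g \<in> Rd d" for g using x that by (simp add: x'_def Rd_def)
  have a'R: "a' g \<in> Rd d" if "g \<in> Rd d" for g unfolding a'_def by (intro Rd_affine x'R a that)
  have step: "acsa_step d Q ((real t + 2) / 2, \<gamma> * (real t + 1)) s
      = distr (Q md) (borel_Rd d \<Otimes>\<^sub>M borel_Rd d) (\<lambda>g. (x' g, a' g))"
    unfolding acsa_step_def s_def by (simp add: \<theta>_def c_def md_def x'_def a'_def Let_def)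
  have [measurable]: "(\<lambda>v. v i) \<in> borel_measurable (Q md)" for i
    using measurable_cong_sets[OF sets_Q[OF mdR] refl] measurable_borel_Rd_coordinate by blast
  have "x' \<in> Q md \<rightarrow>\<^sub>M borel_Rd d" "a' \<in> Q md \<rightarrow>\<^sub>M borel_Rd d"
    using x'R a'R by (auto intro!: measurable_borel_RdI simp: space_Q[OF mdR]) 
      (auto simp: x'_def a'_def)
  then have meas: "(\<lambda>g. (x' g, a' g)) \<in> Q md \<rightarrow>\<^sub>M borel_Rd d \<Otimes>\<^sub>M borel_Rd d"
    by (rule measurable_Pair)
  have th: "0 < \<theta>" "\<theta> \<le> 1" by (auto simp: \<theta>_def)
  \<comment> \<open>H \<theta> c equals 2 H \<gamma> (t + 1) / (t + 2), so 4 H \<gamma> \<le> 1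
    settles the step-size condition for all t at once.\<close>
  have "H * \<gamma> * (4 * (real t + 1)) \<le> 1 * (real t + 2)"
  proof -
    have "(4 * H * \<gamma>) * (real t + 1) \<le> 1 * (real t + 1)"
      using \<gamma> by (intro mult_right_mono) auto
    then show ?thesis by (simp add: algebra_simps)
  qed
  then have c: "0 \<le> c" "H * \<theta> * c \<le> 1 / 2"
    using \<gamma> by (auto simp: c_def \<theta>_def field_simps)
  have k0: "0 < k" by (simp add: k_def)
  have k: "0 \<le> k" "k * (1 - \<theta>) = real t * (real t + 1)" "k * (1 / (\<gamma> * k)) = 1 / \<gamma>"
      "k * (\<theta> * c) = 2 * \<gamma> * (real t + 1)\<^sup>2" "\<theta> = 2 * c * (1 / (\<gamma> * k))"
  proof -
    show "0 \<le> k" "k * (1 / (\<gamma> * k)) = 1 / \<gamma>" using k0 by auto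
    show "k * (1 - \<theta>) = real t * (real t + 1)" "k * (\<theta> * c) = 2 * \<gamma> * (real t + 1)\<^sup>2"
      by (auto simp: k_def \<theta>_def c_def field_simps power2_eq_square)
    have "2 * c * (1 / (\<gamma> * k)) = 2 * (real t + 1) / ((real t + 1) * (real t + 2))"
      using \<gamma> by (simp add: c_def k_def)
    also have "\<dots> = \<theta>" unfolding \<theta>_def by (subst mult.commute, subst mult_divide_mult_cancel_left) auto
    finally show "\<theta> = 2 * c * (1 / (\<gamma> * k))" ..
  qed
  \<comment> \<open>The coefficient of the noise depends on the state alone and not on the answer
    \<open>g\<close>, so its contribution integrates to 0.\<close>
  let ?w = "\<lambda>i. \<theta> * (c * G md i - (x i - u i))"
  have "(\<integral>\<^sup>+s'. ennreal (potential \<gamma> (Suc t) s')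
      \<partial>acsa_step d Q ((real t + 2) / 2, \<gamma> * (real t + 1)) s)
    = (\<integral>\<^sup>+g. ennreal (potential \<gamma> (Suc t) (x' g, a' g)) \<partial>Q md)"
    unfolding step using potential_measurable by (intro nn_integral_distr meas) auto
  also have "\<dots> \<le> ennreal (potential \<gamma> t s + (2 * \<gamma> * (real t + 1)\<^sup>2) * s2)"
  proof (rule nn_integral_le_quadratic[OF mdR, where w = "\<lambda>i. k * ?w i"])
    fix g assume g: "g \<in> Rd d"
    show "0 \<le> potential \<gamma> (Suc t) (x' g, a' g)"
      using \<gamma> x'R[OF g] a'R[OF g] by (intro potential_nonneg) auto
    have "k * (F (a' g) - F u + 1 / (\<gamma> * k) * (vdist d (x' g) u)\<^sup>2) \<le>
      k * ((1 - \<theta>) * (F a - F u) + 1 / (\<gamma> * k) * (vdist d x u)\<^sup>2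
        + vinner d ?w (\<lambda>i. g i - G md i) + \<theta> * c * (vdist d g (G md))\<^sup>2)"
      using acsa_step_pointwise[OF x a g th c k(5) md_def refl refl] k(1)
      unfolding a'_def x'_def by (intro mult_left_mono) auto
    then have "k * (F (a' g) - F u) + (k * (1 / (\<gamma> * k))) * (vdist d (x' g) u)\<^sup>2 \<le>
      (k * (1 - \<theta>)) * (F a - F u) + (k * (1 / (\<gamma> * k))) * (vdist d x u)\<^sup>2
        + k * vinner d ?w (\<lambda>i. g i - G md i) + (k * (\<theta> * c)) * (vdist d g (G md))\<^sup>2"
      by (simp only: distrib_left mult.assoc)
    moreover have "k * vinner d ?w (\<lambda>i. g i - G md i) = vinner d (\<lambda>i. k * ?w i) (\<lambda>i. g i - G md i)"
      by (simp add: vinner_def sum_distrib_left mult.assoc)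
    ultimately show "potential \<gamma> (Suc t) (x' g, a' g) \<le> potential \<gamma> t s
        + vinner d (\<lambda>i. k * ?w i) (\<lambda>i. g i - G md i)
        + 2 * \<gamma> * (real t + 1)\<^sup>2 * (vdist d g (G md))\<^sup>2"
      unfolding k(2-4) by (simp add: potential_def s_def k_def add.commute)
  qed (use \<gamma> in auto)
  finally show ?thesis .
qed

text \<open>The chain is unfolded at its first step, so the induction runs from \<open>T\<close>
  downwards with the state arbitrary: the hypothesis is used inside the integral over the next
  state, and \<open>potential_step\<close> bounds the outer integral.\<close>

lemma potential_iterate:
  assumes \<gamma>: "0 < \<gamma>" "4 * H * \<gamma> \<le> 1" and "s \<in> Rd d \<times> Rd d" and "t \<le> T"
  shows "(\<integral>\<^sup>+s'. ennreal (potential \<gamma> T s') \<partial>acsa_iterate d Q (stage_params \<gamma> t T) s)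
    \<le> ennreal (potential \<gamma> t s + (\<Sum>j\<in>{t..<T}. 2 * \<gamma> * (real j + 1)\<^sup>2 * s2))"
  using assms(4,3)
proof (induction arbitrary: s rule: inc_induct)
  case base
  then show ?case
    using potential_measurable
    by (simp add: stage_params_def nn_integral_return space_pair_measure)
next
  case (step t)
  let ?P = "borel_Rd d \<Otimes>\<^sub>M borel_Rd d"
  let ?p = "((real t + 2) / 2, \<gamma> * (real t + 1))"
  let ?N = "\<Sum>j\<in>{Suc t..<T}. 2 * \<gamma> * (real j + 1)\<^sup>2 * s2"
  have N: "0 \<le> ?N" using \<gamma> s2_nonneg by (intro sum_nonneg) auto
  have st: "acsa_step d Q ?p s \<in> space (prob_algebra ?P)"
    using measurable_space[OF measurable_acsa_step[OF kernel]] step.prems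
    by (auto simp: space_pair_measure)
  then have sets: "sets (acsa_step d Q ?p s) = sets ?P" by (simp add: space_prob_algebra)
  interpret prob_space "acsa_step d Q ?p s" using st by (simp add: space_prob_algebra)
  have space: "space (acsa_step d Q ?p s) = Rd d \<times> Rd d"
    using sets_eq_imp_space_eq[OF sets] by (simp add: space_pair_measure)
  have eq: "stage_params \<gamma> t T = ?p # stage_params \<gamma> (Suc t) T"
    using step.hyps by (simp add: stage_params_def upt_conv_Cons)
  have K: "acsa_iterate d Q (stage_params \<gamma> (Suc t) T) \<in> acsa_step d Q ?p s \<rightarrow>\<^sub>M subprob_algebra ?P"
    using measurable_prob_algebraD[OF measurable_acsa_iterate[OF kernel]]
      measurable_cong_sets[OF sets refl] by blast
  have m: "(\<lambda>s'. ennreal (potential \<gamma> (Suc t) s')) \<in> borel_measurable (acsa_step d Q ?p s)"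
    using potential_measurable measurable_cong_sets[OF sets refl] by (intro measurable_compose[OF _ measurable_ennreal]) blast
  have "(\<integral>\<^sup>+s'. ennreal (potential \<gamma> T s') \<partial>acsa_iterate d Q (stage_params \<gamma> t T) s)
      = (\<integral>\<^sup>+s1. \<integral>\<^sup>+s'. ennreal (potential \<gamma> T s')
          \<partial>acsa_iterate d Q (stage_params \<gamma> (Suc t) T) s1 \<partial>acsa_step d Q ?p s)"
    unfolding eq acsa_iterate.simps using potential_measurable by (intro nn_integral_bind[OF _ K]) auto
  also have "\<dots> \<le> (\<integral>\<^sup>+s1. ennreal (potential \<gamma> (Suc t) s1) + ennreal ?N \<partial>acsa_step d Q ?p s)"
    using step.IH potential_nonneg[OF \<gamma>(1)] N
    by (intro nn_integral_mono) (auto simp: space ennreal_plus[symmetric] simp del: ennreal_plus)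
  also have "\<dots> = (\<integral>\<^sup>+s1. ennreal (potential \<gamma> (Suc t) s1) \<partial>acsa_step d Q ?p s) + ennreal ?N"
    by (subst nn_integral_add[OF m]) (auto simp: emeasure_space_1)
  also have "\<dots> \<le> ennreal (potential \<gamma> t s + 2 * \<gamma> * (real t + 1)\<^sup>2 * s2) + ennreal ?N"
    by (intro add_right_mono potential_step \<gamma> step.prems)
  also have "\<dots> = ennreal (potential \<gamma> t s + (\<Sum>j\<in>{t..<T}. 2 * \<gamma> * (real j + 1)\<^sup>2 * s2))"
    using step.hyps N potential_nonneg[OF \<gamma>(1) step.prems] s2_nonneg \<gamma>
    by (subst ennreal_plus[symmetric]) (auto simp: sum.atLeast_Suc_lessThan)
  finally show ?case .
qed

end

subsection \<open>Composing stages\<close>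

text \<open>With gamma = 0 the iterate does not move, and with beta = 1 the aggregate equals it;
  answers are drawn and ignored. Such stages fill up the budget of rounds, or form the whole
  schedule when the starting point is good enough.\<close>

lemma acsa_idle:
  assumes Q: "Q \<in> borel_Rd d \<rightarrow>\<^sub>M prob_algebra (borel_Rd d)" and x: "x \<in> Rd d"
  shows "acsa d Q (replicate r (1, 0)) x = return (borel_Rd d) x"
proof -
  let ?P = "borel_Rd d \<Otimes>\<^sub>M borel_Rd d"
  have xx: "(x, x) \<in> space ?P" using x by (simp add: space_pair_measure)
  interpret prob_space "Q x" using measurable_space[OF Q, of x] x by (simp add: space_prob_algebra)
  have step: "acsa_step d Q (1, 0) (x, x) = return ?P (x, x)"
    using distr_const[OF xx] by (simp add: acsa_step_def Let_def)
  have "acsa_iterate d Q (replicate r (1, 0)) (x, x) = return ?P (x, x)"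
  proof (induction r)
    case (Suc r)
    then show ?case
      using bind_return[OF measurable_prob_algebraD[OF measurable_acsa_iterate[OF Q]] xx]
      by (simp add: step)
  qed simp
  then show ?thesis
    using distr_return[OF measurable_snd xx] by (simp add: acsa_def)
qed

text \<open>Markov property of the chain of stages, by associativity of \<open>bind\<close>.\<close>

lemma multistage_acsa_append:
  assumes Q: "Q \<in> borel_Rd d \<rightarrow>\<^sub>M prob_algebra (borel_Rd d)" and x: "x \<in> Rd d"
  shows "multistage_acsa d Q (ss @ ts) x = bind (multistage_acsa d Q ss x) (multistage_acsa d Q ts)"
  using x
proof (induction ss arbitrary: x)
  case Nil
  then show ?case
    using bind_return[OF measurable_prob_algebraD[OF measurable_multistage_acsa[OF Q]]] by simp
next
  case (Cons s ss)
  have A: "acsa d Q s x \<in> space (prob_algebra (borel_Rd d))"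
    using measurable_space[OF measurable_acsa[OF Q]] Cons.prems by auto
  then have sets: "sets (acsa d Q s x) = sets (borel_Rd d)" by (simp add: space_prob_algebra)
  have m: "multistage_acsa d Q ss \<in> acsa d Q s x \<rightarrow>\<^sub>M subprob_algebra (borel_Rd d)"
    using measurable_prob_algebraD[OF measurable_multistage_acsa[OF Q]]
      measurable_cong_sets[OF sets refl] by blast
  have "multistage_acsa d Q ((s # ss) @ ts) x
      = bind (acsa d Q s x) (\<lambda>y. bind (multistage_acsa d Q ss y) (multistage_acsa d Q ts))"
    using Cons.IH sets_eq_imp_space_eq[OF sets] by (auto intro!: bind_cong)
  also have "\<dots> = bind (multistage_acsa d Q (s # ss) x) (multistage_acsa d Q ts)"
    using bind_assoc[OF m measurable_prob_algebraD[OF measurable_multistage_acsa[OF Q]]] by simp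
  finally show ?case .
qed

text \<open>The bound contains the final weight T (T + 1) of the potential, so that a single factor
  T remains after normalization.\<close>

lemma sum_squares_le: "2 * (\<Sum>j\<in>{0..<T}. (real j + 1)\<^sup>2) \<le> (real T)\<^sup>2 * (real T + 1)"
proof (induction T)
  case (Suc T)
  have "(real T)\<^sup>2 * (real T + 1) + 2 * (real T + 1)\<^sup>2 \<le> (real (Suc T))\<^sup>2 * (real (Suc T) + 1)"
    by (simp add: power2_eq_square algebra_simps)
  then show ?case using Suc by simp
qed simp

context stochastic_gradient
begin

lemma stage_bound:
  assumes x: "x \<in> Rd d" and T: "64 * H \<le> l * (real T)\<^sup>2"
  shows "(\<integral>\<^sup>+y. ennreal (F y - F u) \<partial>acsa d Q (stage l T) x)
    \<le> ennreal (1/4 * (F x - F u) + 16 * s2 / (l * real T))"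
proof -
  define \<gamma> where "\<gamma> = 16 / (l * (real T)\<^sup>2)"
  have T0: "0 < real T" using T H_pos by (cases "T = 0") auto
  have \<gamma>: "0 < \<gamma>" "4 * H * \<gamma> \<le> 1"
    using T T0 l_pos by (auto simp: \<gamma>_def field_simps)
  define k where "k = real T * (real T + 1)"
  have k: "0 < k" using T0 by (simp add: k_def)
  let ?P = "borel_Rd d \<Otimes>\<^sub>M borel_Rd d"
  let ?\<mu> = "acsa_iterate d Q (stage l T) (x, x)"
  have "?\<mu> \<in> space (prob_algebra ?P)"
    using measurable_space[OF measurable_acsa_iterate[OF kernel]] x by (auto simp: space_pair_measure)
  then have sets: "sets ?\<mu> = sets ?P" by (simp add: space_prob_algebra)
  have space: "space ?\<mu> = Rd d \<times> Rd d"
    using sets_eq_imp_space_eq[OF sets] by (simp add: space_pair_measure)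
  have snd: "snd \<in> ?\<mu> \<rightarrow>\<^sub>M borel_Rd d"
    using measurable_cong_sets[OF sets refl] measurable_snd by blast
  have pm: "(\<lambda>s. ennreal (potential \<gamma> T s)) \<in> borel_measurable ?\<mu>"
    using potential_measurable measurable_cong_sets[OF sets refl]
    by (intro measurable_compose[OF _ measurable_ennreal]) blast
  have "(\<integral>\<^sup>+y. ennreal (F y - F u) \<partial>acsa d Q (stage l T) x)
      = (\<integral>\<^sup>+s. ennreal (F (snd s) - F u) \<partial>?\<mu>)"
    unfolding acsa_def using F_measurable by (intro nn_integral_distr snd) auto
  also have "\<dots> \<le> (\<integral>\<^sup>+s. ennreal (1 / k) * ennreal (potential \<gamma> T s) \<partial>?\<mu>)"
  proof (intro nn_integral_mono)
    fix s assume "s \<in> space ?\<mu>"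
    then have s: "s \<in> Rd d \<times> Rd d" by (simp add: space)
    have "k * (F (snd s) - F u) \<le> potential \<gamma> T s"
      using \<gamma> by (simp add: potential_def k_def)
    then have "F (snd s) - F u \<le> 1 / k * potential \<gamma> T s"
      using k by (simp add: field_simps)
    then show "ennreal (F (snd s) - F u) \<le> ennreal (1 / k) * ennreal (potential \<gamma> T s)"
      using k potential_nonneg[OF \<gamma>(1) s] by (simp add: ennreal_mult[symmetric] ennreal_leI)
  qed
  also have "\<dots> = ennreal (1 / k) * (\<integral>\<^sup>+s. ennreal (potential \<gamma> T s) \<partial>?\<mu>)"
    by (rule nn_integral_cmult[OF pm])
  also have "\<dots> \<le> ennreal (1 / k)
      * ennreal (potential \<gamma> 0 (x, x) + (\<Sum>j\<in>{0..<T}. 2 * \<gamma> * (real j + 1)\<^sup>2 * s2))"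
    unfolding stage_def \<gamma>_def[symmetric]
    using x by (intro mult_left_mono potential_iterate \<gamma>) auto
  also have "\<dots> = ennreal (1 / k * (potential \<gamma> 0 (x, x) + (\<Sum>j\<in>{0..<T}. 2 * \<gamma> * (real j + 1)\<^sup>2 * s2)))"
    using k potential_nonneg[OF \<gamma>(1), of "(x, x)" 0] x \<gamma> s2_nonneg
    by (intro ennreal_mult[symmetric] add_nonneg_nonneg sum_nonneg) auto
  also have "\<dots> \<le> ennreal (1/4 * (F x - F u) + 16 * s2 / (l * real T))"
  proof (rule ennreal_leI)
    have d0: "0 \<le> F x - F u" using u_min[OF x] by simp
    \<comment> \<open>At t = 0 only the distance is left. The constant 4 / l of the distance bound
      and 1 / \<gamma> = l T^2 / 16 combine to T^2 / 4, at most a quarter of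
      \<open>k\<close>.\<close>
    have "potential \<gamma> 0 (x, x) \<le> 4 / l * (F x - F u) / \<gamma>"
      using divide_right_mono[OF vdist_minimizer_le[OF x], of \<gamma>] \<gamma> by (simp add: potential_def)
    also have "\<dots> = (real T)\<^sup>2 / 4 * (F x - F u)"
      using T0 l_pos by (simp add: \<gamma>_def field_simps)
    also have "\<dots> \<le> k / 4 * (F x - F u)"
      using d0 T0 by (intro mult_right_mono) (auto simp: k_def power2_eq_square)
    finally have 1: "potential \<gamma> 0 (x, x) \<le> k * (1/4 * (F x - F u))" by simp
    have "(\<Sum>j\<in>{0..<T}. 2 * \<gamma> * (real j + 1)\<^sup>2 * s2) = \<gamma> * s2 * (2 * (\<Sum>j\<in>{0..<T}. (real j + 1)\<^sup>2))"
      by (simp add: sum_distrib_left mult_ac)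
    also have "\<dots> \<le> \<gamma> * s2 * ((real T)\<^sup>2 * (real T + 1))"
      using \<gamma> s2_nonneg by (intro mult_left_mono sum_squares_le) auto
    also have "\<dots> = k * (\<gamma> * s2 * real T)" by (simp add: k_def power2_eq_square)
    also have "\<gamma> * s2 * real T = 16 * s2 / (l * real T)"
      using T0 by (simp add: \<gamma>_def power2_eq_square)
    finally have "potential \<gamma> 0 (x, x) + (\<Sum>j\<in>{0..<T}. 2 * \<gamma> * (real j + 1)\<^sup>2 * s2)
        \<le> k * (1/4 * (F x - F u) + 16 * s2 / (l * real T))"
      using 1 by (simp only: distrib_left)
    then show "1 / k * (potential \<gamma> 0 (x, x) + (\<Sum>j\<in>{0..<T}. 2 * \<gamma> * (real j + 1)\<^sup>2 * s2))
        \<le> 1/4 * (F x - F u) + 16 * s2 / (l * real T)"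
      using k by (simp add: divide_le_eq mult.commute)
  qed
  finally show ?thesis .
qed

text \<open>Uniformity in the starting point allows use after random stages. The sign conditions
  keep \<open>ennreal\<close> from truncating when guarantees are composed.\<close>

definition contracts :: "(real \<times> real) list list \<Rightarrow> real \<Rightarrow> real \<Rightarrow> bool" where
  "contracts ss q n \<longleftrightarrow> 0 \<le> q \<and> 0 \<le> n \<and> (\<forall>x\<in>Rd d.
     (\<integral>\<^sup>+y. ennreal (F y - F u) \<partial>multistage_acsa d Q ss x) \<le> ennreal (q * (F x - F u) + n))"

lemma multistage_singleton:
  assumes "x \<in> Rd d"
  shows "multistage_acsa d Q [s] x = acsa d Q s x"
proof -
  have sets: "sets (acsa d Q s x) = sets (borel_Rd d)"
    using measurable_space[OF measurable_acsa[OF kernel], of x s] assms by (auto simp: space_prob_algebra)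
  then show ?thesis
    using bind_return''[OF sets] by (simp cong: bind_cong)
qed

lemma contracts_Nil: "contracts [] 1 0"
  using F_measurable by (auto simp: contracts_def nn_integral_return)

lemma contracts_stage:
  "64 * H \<le> l * (real T)\<^sup>2 \<Longrightarrow> contracts [stage l T] (1/4) (16 * s2 / (l * real T))"
  using stage_bound s2_nonneg l_pos by (simp add: contracts_def multistage_singleton del: multistage_acsa.simps)

lemma contracts_idle: "contracts [replicate r (1, 0)] 1 0"
  using F_measurable
  by (simp add: contracts_def multistage_singleton acsa_idle[OF kernel] nn_integral_return del: multistage_acsa.simps)

lemma contracts_mono: "contracts ss q n \<Longrightarrow> q \<le> q' \<Longrightarrow> n \<le> n' \<Longrightarrow> contracts ss q' n'"
  unfolding contracts_def
proof (safe)
  fix x assume h: "0 \<le> q" "0 \<le> n" "q \<le> q'" "n \<le> n'" and x: "x \<in> Rd d"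
    and b: "\<forall>x\<in>Rd d. (\<integral>\<^sup>+y. ennreal (F y - F u) \<partial>multistage_acsa d Q ss x) \<le> ennreal (q * (F x - F u) + n)"
  have "q * (F x - F u) + n \<le> q' * (F x - F u) + n'"
    using h u_min[OF x] by (intro add_mono mult_right_mono) auto
  then show "(\<integral>\<^sup>+y. ennreal (F y - F u) \<partial>multistage_acsa d Q ss x) \<le> ennreal (q' * (F x - F u) + n')"
    using b x by (blast intro: order_trans ennreal_leI)
qed auto

text \<open>Given the output z of \<open>ss\<close>, the guarantee of \<open>ts\<close> is affine in
  \<open>F z - F u\<close>, so integrating over z inserts the guarantee of \<open>ss\<close>: the
  two affine maps are composed.\<close>

lemma contracts_append:
  assumes ss: "contracts ss q n" and ts: "contracts ts q' n'"
  shows "contracts (ss @ ts) (q' * q) (q' * n + n')"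
proof -
  have q: "0 \<le> q" "0 \<le> n" "0 \<le> q'" "0 \<le> n'" using ss ts by (auto simp: contracts_def)
  have "(\<integral>\<^sup>+y. ennreal (F y - F u) \<partial>multistage_acsa d Q (ss @ ts) x)
      \<le> ennreal (q' * q * (F x - F u) + (q' * n + n'))" if x: "x \<in> Rd d" for x
  proof -
    let ?\<mu> = "multistage_acsa d Q ss x"
    have A: "?\<mu> \<in> space (prob_algebra (borel_Rd d))"
      using measurable_space[OF measurable_multistage_acsa[OF kernel]] x by auto
    then have sets: "sets ?\<mu> = sets (borel_Rd d)" by (simp add: space_prob_algebra)
    interpret prob_space ?\<mu> using A by (simp add: space_prob_algebra)
    have K: "multistage_acsa d Q ts \<in> ?\<mu> \<rightarrow>\<^sub>M subprob_algebra (borel_Rd d)"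
      using measurable_prob_algebraD[OF measurable_multistage_acsa[OF kernel]]
        measurable_cong_sets[OF sets refl] by blast
    have m: "(\<lambda>y. ennreal (F y - F u)) \<in> borel_measurable ?\<mu>"
      using F_measurable measurable_cong_sets[OF sets refl]
      by (intro measurable_compose[OF _ measurable_ennreal] borel_measurable_diff) auto
    have "(\<integral>\<^sup>+y. ennreal (F y - F u) \<partial>multistage_acsa d Q (ss @ ts) x)
        = (\<integral>\<^sup>+z. \<integral>\<^sup>+y. ennreal (F y - F u) \<partial>multistage_acsa d Q ts z \<partial>?\<mu>)"
      unfolding multistage_acsa_append[OF kernel x]
      using F_measurable by (intro nn_integral_bind[OF _ K]) auto
    also have "\<dots> \<le> (\<integral>\<^sup>+z. ennreal q' * ennreal (F z - F u) + ennreal n' \<partial>?\<mu>)"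
      using ts q u_min sets_eq_imp_space_eq[OF sets]
      by (intro nn_integral_mono)
        (auto simp: contracts_def ennreal_plus[symmetric] ennreal_mult[symmetric] simp del: ennreal_plus)
    also have "\<dots> = ennreal q' * (\<integral>\<^sup>+z. ennreal (F z - F u) \<partial>?\<mu>) + ennreal n'"
      using m by (subst nn_integral_add) (auto simp: nn_integral_cmult emeasure_space_1)
    also have "\<dots> \<le> ennreal q' * ennreal (q * (F x - F u) + n) + ennreal n'"
      using ss x by (intro add_right_mono mult_left_mono) (auto simp: contracts_def)
    also have "\<dots> = ennreal (q' * q * (F x - F u) + (q' * n + n'))"
    proof -
      have 0: "0 \<le> q * (F x - F u) + n" using q u_min[OF x] by simp
      have "ennreal q' * ennreal (q * (F x - F u) + n) + ennreal n'
          = ennreal (q' * (q * (F x - F u) + n) + n')"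
        using q 0 by (simp only: ennreal_mult[symmetric] ennreal_plus[symmetric] mult_nonneg_nonneg)
      then show ?thesis by (simp only: distrib_left mult.assoc add.assoc)
    qed
    finally show ?thesis .
  qed
  then show ?thesis using q by (simp add: contracts_def)
qed

text \<open>The recursion n -> n / 4 + 16 s2 / (l T) preserves the bound 64 s2 / (l T). The constant
  64 is chosen for the doubling of lengths that follows.\<close>

lemma contracts_replicate:
  assumes T: "64 * H \<le> l * (real T)\<^sup>2"
  shows "contracts (replicate N (stage l T)) ((1/4) ^ N) (64 * s2 / (l * real T))"
proof (induction N)
  case 0
  show ?case
    by simp (rule contracts_mono[OF contracts_Nil], use s2_nonneg l_pos in auto)
next
  case (Suc N)
  have "1/4 * (64 * s2 / (l * real T)) + 16 * s2 / (l * real T) \<le> 64 * s2 / (l * real T)"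
    using s2_nonneg l_pos by (cases "T = 0") (auto simp: field_simps)
  then show ?case
    using contracts_mono[OF contracts_append[OF Suc contracts_stage[OF T]] order_refl]
    by (simp add: replicate_append_same)
qed

text \<open>In a stage of length P = T 2^m the incoming noise 64 s2 / (l P) is quartered and 16 s2 /
  (l P) is added; the result 32 s2 / (l P) is exactly the bound claimed for length 2 P. The extra
  contraction of the initial error is given away.\<close>

lemma contracts_doubling:
  assumes T: "64 * H \<le> l * (real T)\<^sup>2"
  shows "contracts (replicate N (stage l T) @ map (\<lambda>k. stage l (T * 2 ^ k)) [0..<m])
    ((1/4) ^ N) (64 * s2 / (l * real (T * 2 ^ m)))"
proof (induction m)
  case 0
  show ?case using contracts_replicate[OF T] by simp
next
  case (Suc m)
  have "real T \<le> real (T * 2 ^ m)" by (subst of_nat_le_iff) simp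
  then have "l * (real T)\<^sup>2 \<le> l * (real (T * 2 ^ m))\<^sup>2"
    using l_pos by (intro mult_left_mono power_mono) auto
  then have T': "64 * H \<le> l * (real (T * 2 ^ m))\<^sup>2" using T by linarith
  have "1/4 * (64 * s2 / (l * real (T * 2 ^ m))) + 16 * s2 / (l * real (T * 2 ^ m))
      = 64 * s2 / (l * real (T * 2 ^ Suc m))"
    by (simp add: field_simps)
  then show ?case
    using contracts_mono[OF contracts_append[OF Suc contracts_stage[OF T']], of "(1/4) ^ N"]
    by simp
qed

end

subsection \<open>The minibatch oracle\<close>

text \<open>It suffices to test boxes, an intersection-stable generator; the measure of a box is a
  finite product of kernel values, each measurable in the parameter.\<close>

lemma measurable_PiM_kernel:
  assumes I: "finite I" and \<kappa>: "\<And>q. q \<in> I \<Longrightarrow> \<kappa> q \<in> L \<rightarrow>\<^sub>M prob_algebra (N q)"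
  shows "(\<lambda>x. Pi\<^sub>M I (\<lambda>q. \<kappa> q x)) \<in> L \<rightarrow>\<^sub>M prob_algebra (Pi\<^sub>M I N)"
proof (rule measurable_prob_algebra_generated[OF sets_PiM Int_stable_prod_algebra prod_algebra_sets_into_space])
  fix x assume x: "x \<in> space L"
  have K: "prob_space (\<kappa> q x)" "sets (\<kappa> q x) = sets (N q)" if "q \<in> I" for q
    using measurable_space[OF \<kappa>[OF that] x] by (auto simp: space_prob_algebra)
  show "prob_space (Pi\<^sub>M I (\<lambda>q. \<kappa> q x))" by (intro prob_space_PiM K)
  show "sets (Pi\<^sub>M I (\<lambda>q. \<kappa> q x)) = sets (Pi\<^sub>M I N)" by (intro sets_PiM_cong K refl)
next
  fix A assume "A \<in> prod_algebra I N"
  then obtain E where A: "A = Pi\<^sub>E I E" and E: "E \<in> (\<Pi> q\<in>I. sets (N q))"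
    by (rule prod_algebraE_all)
  have "emeasure (Pi\<^sub>M I (\<lambda>q. \<kappa> q x)) A = (\<Prod>q\<in>I. emeasure (\<kappa> q x) (E q))" if x: "x \<in> space L" for x
  proof -
    have K: "prob_space (\<kappa> q x)" "sets (\<kappa> q x) = sets (N q)" if "q \<in> I" for q
      using measurable_space[OF \<kappa>[OF that] x] by (auto simp: space_prob_algebra)
    have "prod_emb I (\<lambda>q. \<kappa> q x) I (Pi\<^sub>E I E) = Pi\<^sub>E I E"
    proof (rule prod_emb_PiE_same_index)
      fix q assume q: "q \<in> I"
      then have "E q \<in> sets (\<kappa> q x)" using E K(2) by auto
      then show "E q \<subseteq> space (\<kappa> q x)" by (rule sets.sets_into_space)
    qed
    then show ?thesis
      using emeasure_PiM_emb[of I "\<lambda>q. \<kappa> q x" I E] I E K by (auto simp: A)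
  qed
  moreover have "(\<lambda>x. \<Prod>q\<in>I. emeasure (\<kappa> q x) (E q)) \<in> borel_measurable L"
    using E by (intro borel_measurable_prod_ennreal
        measurable_emeasure_kernel[OF measurable_prob_algebraD[OF \<kappa>]]) auto
  ultimately show "(\<lambda>x. emeasure (Pi\<^sub>M I (\<lambda>q. \<kappa> q x)) A) \<in> borel_measurable L"
    by (simp cong: measurable_cong)
qed

section \<open>Moments under finite product measures\<close>

lemma has_bochner_integral_PiM_component:
  fixes f :: "'b \<Rightarrow> real"
  assumes N: "\<And>q. q \<in> I \<Longrightarrow> prob_space (N q)" and p: "p \<in> I"
    and f: "has_bochner_integral (N p) f c"
  shows "has_bochner_integral (Pi\<^sub>M I N) (\<lambda>\<omega>. f (\<omega> p)) c"
proof -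
  have "has_bochner_integral (distr (Pi\<^sub>M I N) (N p) (\<lambda>\<omega>. \<omega> p)) f c"
    by (subst distr_PiM_component[OF N p]) (use f in auto)
  moreover have "f \<in> borel_measurable (N p)" using f by (auto simp: has_bochner_integral_iff)
  ultimately show ?thesis
    using measurable_component_singleton[OF p, of N]
    by (auto simp: has_bochner_integral_iff integrable_distr_eq integral_distr)
qed

text \<open>An instance of the product formula over all coordinates, with the factor 1 at every
  coordinate other than \<open>p\<close> and \<open>q\<close>.\<close>

lemma product_expectation_PiM:
  fixes X :: "'q \<Rightarrow> 'b \<Rightarrow> real"
  assumes I: "finite I" and N: "\<And>q. q \<in> I \<Longrightarrow> prob_space (N q)"
    and X: "\<And>q. q \<in> I \<Longrightarrow> integrable (N q) (X q)"
    and pq: "p \<in> I" "q \<in> I" "p \<noteq> q"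
  shows "has_bochner_integral (Pi\<^sub>M I N) (\<lambda>\<omega>. X p (\<omega> p) * X q (\<omega> q))
    (integral\<^sup>L (N p) (X p) * integral\<^sup>L (N q) (X q))"
proof -
  \<comment> \<open>The locale of product probability spaces speaks about all indices; a point mass
    outside \<open>I\<close> leaves the product over \<open>I\<close> unchanged.\<close>
  define N' where "N' r = (if r \<in> I then N r else return (count_space UNIV) undefined)" for r
  have N': "prob_space (N' r)" for r
    using N by (simp add: N'_def prob_space_return)
  interpret product_prob_space N' I
    using N' by (simp add: product_prob_space_def product_prob_space_axioms_def
      product_sigma_finite_def prob_space_imp_sigma_finite)
  have PiM: "Pi\<^sub>M I N' = Pi\<^sub>M I N" by (rule PiM_cong) (auto simp: N'_def)
  define f where "f r = (\<lambda>v. (if r = p then X p v else 1) * (if r = q then X q v else 1))" for r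
  have f: "integrable (N' r) (f r)" if "r \<in> I" for r
    using X[OF that] pq that prob_space.finite_measure[OF N'[of r]]
    by (cases "r = p"; cases "r = q") (auto simp: f_def N'_def finite_measure.integrable_const)
  have prod: "(\<Prod>r\<in>I. f r (\<omega> r)) = X p (\<omega> p) * X q (\<omega> q)" for \<omega>
    using I pq by (simp add: f_def prod.distrib)
  have "(\<Prod>r\<in>I. integral\<^sup>L (N' r) (f r))
      = (\<Prod>r\<in>I. (if r = p then integral\<^sup>L (N p) (X p) else 1) * (if r = q then integral\<^sup>L (N q) (X q) else 1))"
    using pq prob_space.prob_space[OF N] by (intro prod.cong) (auto simp: f_def N'_def)
  also have "\<dots> = integral\<^sup>L (N p) (X p) * integral\<^sup>L (N q) (X q)"
    using I pq by (simp add: prod.distrib)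
  finally show ?thesis
    using product_integrable_prod[OF I f] product_integral_prod[OF I f]
    by (simp add: has_bochner_integral_iff prod PiM)
qed

text \<open>Off the diagonal the expectations factor by independence and vanish because the means
  are 0. This is the source of the variance reduction by the batch size.\<close>

lemma variance_sum_PiM:
  fixes X :: "'q \<Rightarrow> 'b \<Rightarrow> real"
  assumes I: "finite I" and N: "\<And>q. q \<in> I \<Longrightarrow> prob_space (N q)"
    and X: "\<And>q. q \<in> I \<Longrightarrow> has_bochner_integral (N q) (X q) 0"
    and X2: "\<And>q. q \<in> I \<Longrightarrow> integrable (N q) (\<lambda>v. (X q v)\<^sup>2)"
  shows "has_bochner_integral (Pi\<^sub>M I N) (\<lambda>\<omega>. (\<Sum>q\<in>I. X q (\<omega> q))\<^sup>2) (\<Sum>q\<in>I. \<integral>v. (X q v)\<^sup>2 \<partial>N q)"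
proof -
  have "has_bochner_integral (Pi\<^sub>M I N) (\<lambda>\<omega>. X p (\<omega> p) * X q (\<omega> q))
      (if p = q then \<integral>v. (X p v)\<^sup>2 \<partial>N p else 0)" if "p \<in> I" "q \<in> I" for p q
  proof (cases "p = q")
    case True
    then show ?thesis
      using has_bochner_integral_PiM_component[where f = "\<lambda>v. (X p v)\<^sup>2" and N = N, OF N \<open>p \<in> I\<close>
          has_bochner_integral_integrable[OF X2[OF \<open>p \<in> I\<close>]]]
      by (simp add: power2_eq_square)
  next
    case False
    then show ?thesis
      using product_expectation_PiM[where X = X, OF I N _ that] X that by (auto simp: has_bochner_integral_iff)
  qed
  then have "has_bochner_integral (Pi\<^sub>M I N) (\<lambda>\<omega>. \<Sum>p\<in>I. \<Sum>q\<in>I. X p (\<omega> p) * X q (\<omega> q))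
      (\<Sum>p\<in>I. \<Sum>q\<in>I. if p = q then \<integral>v. (X p v)\<^sup>2 \<partial>N p else 0)"
    by (intro has_bochner_integral_sum)
  then show ?thesis
    using I by (simp add: power2_eq_square sum_product)
qed

lemma measurable_minibatch_average:
  "(\<lambda>g i. (\<Sum>q\<in>{..<M} \<times> {..<K}. g q i) / (real M * real K))
    \<in> Pi\<^sub>M ({..<M} \<times> {..<K}) (\<lambda>_. borel_Rd d) \<rightarrow>\<^sub>M borel_Rd d"
proof (rule measurable_borel_RdI)
  fix g assume "g \<in> space (Pi\<^sub>M ({..<M} \<times> {..<K}) (\<lambda>_. borel_Rd d))"
  then have "g q \<in> Rd d" if "q \<in> {..<M} \<times> {..<K}" for q using that by (auto simp: space_PiM)
  then show "(\<lambda>i. (\<Sum>q\<in>{..<M} \<times> {..<K}. g q i) / (real M * real K)) \<in> Rd d"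
    by (auto simp: Rd_def intro!: sum.neutral)
next
  fix i
  show "(\<lambda>g. (\<Sum>q\<in>{..<M} \<times> {..<K}. g q i) / (real M * real K))
      \<in> borel_measurable (Pi\<^sub>M ({..<M} \<times> {..<K}) (\<lambda>_. borel_Rd d))"
    by (intro borel_measurable_divide borel_measurable_const borel_measurable_sum
        measurable_coordinate_comp[where d = d] measurable_component_singleton[where M = "\<lambda>_. borel_Rd d"])
qed

lemma measurable_minibatch_oracle:
  assumes orc: "\<And>m. m < M \<Longrightarrow> orc m \<in> borel_Rd d \<rightarrow>\<^sub>M prob_algebra (borel_Rd d)"
  shows "minibatch_oracle d M K orc \<in> borel_Rd d \<rightarrow>\<^sub>M prob_algebra (borel_Rd d)"
proof -
  let ?I = "{..<M} \<times> {..<K}"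
  have "(\<lambda>x. Pi\<^sub>M ?I (\<lambda>q. orc (fst q) x)) \<in> borel_Rd d \<rightarrow>\<^sub>M prob_algebra (Pi\<^sub>M ?I (\<lambda>_. borel_Rd d))"
    using orc by (intro measurable_PiM_kernel) auto
  from measurable_compose[OF this measurable_distr_prob_space[OF measurable_minibatch_average]]
  show ?thesis by (simp add: minibatch_oracle_def[abs_def])
qed

text \<open>All answers refer to the same point, and each is centered at the gradient of its own
  component. Differences between components thus enter the mean only, and the n = M K independent
  deviations contribute at most n \<sigma>^2 / n^2.\<close>

lemma minibatch_oracle_moments:
  assumes M: "1 \<le> M" and K: "1 \<le> K" and \<sigma>: "0 \<le> \<sigma>" and x: "x \<in> Rd d"
    and orc: "\<And>m. m < M \<Longrightarrow> stochastic_gradient_oracle d \<sigma> (Fs m) (orc m)"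
    and g: "\<And>m. m < M \<Longrightarrow> has_gradient d (Fs m) x (g m)"
  defines "gbar \<equiv> (\<lambda>i. (\<Sum>m<M. g m i) / real M)"
  shows "i < d \<Longrightarrow> has_bochner_integral (minibatch_oracle d M K orc x) (\<lambda>v. v i) (gbar i)"
    and "(\<integral>\<^sup>+v. ennreal ((vdist d v gbar)\<^sup>2) \<partial>minibatch_oracle d M K orc x)
      \<le> ennreal (\<sigma>\<^sup>2 / (real M * real K))"
proof -
  define I where "I = {..<M} \<times> {..<K}"
  define N where "N q = orc (fst q) x" for q :: "nat \<times> nat"
  define h where "h q = g (fst q)" for q :: "nat \<times> nat"
  define n where "n = real M * real K"
  define avg where "avg = (\<lambda>(\<omega> :: nat \<times> nat \<Rightarrow> vec) i. (\<Sum>q\<in>I. \<omega> q i) / n)"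
  have I: "finite I" by (simp add: I_def)
  have n: "0 < n" "real (card I) = n" using M K by (auto simp: n_def I_def)
  have orcq: "orc (fst q) \<in> borel_Rd d \<rightarrow>\<^sub>M prob_algebra (borel_Rd d)"
      "(\<forall>i<d. has_bochner_integral (orc (fst q) x) (\<lambda>v. v i) (g (fst q) i)) \<and>
        (\<integral>\<^sup>+v. ennreal ((vdist d v (g (fst q)))\<^sup>2) \<partial>orc (fst q) x) \<le> ennreal (\<sigma>\<^sup>2)"
    if "q \<in> I" for q
  proof -
    have "fst q < M" using that by (auto simp: I_def)
    then show "orc (fst q) \<in> borel_Rd d \<rightarrow>\<^sub>M prob_algebra (borel_Rd d)"
      "(\<forall>i<d. has_bochner_integral (orc (fst q) x) (\<lambda>v. v i) (g (fst q) i)) \<and>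
        (\<integral>\<^sup>+v. ennreal ((vdist d v (g (fst q)))\<^sup>2) \<partial>orc (fst q) x) \<le> ennreal (\<sigma>\<^sup>2)"
      using orc[of "fst q"] g[of "fst q"] x unfolding stochastic_gradient_oracle_def by blast+
  qed
  have N: "N q \<in> space (prob_algebra (borel_Rd d))" if "q \<in> I" for q
    using measurable_space[OF orcq(1)[OF that], of x] x by (simp add: N_def)
  then have prob: "prob_space (N q)" and sets: "sets (N q) = sets (borel_Rd d)" if "q \<in> I" for q
    using that by (auto simp: space_prob_algebra)
  have mean: "has_bochner_integral (N q) (\<lambda>v. v i) (h q i)" if "q \<in> I" "i < d" for q i
    using orcq(2)[OF that(1)] that by (simp add: N_def h_def)
  have var: "(\<integral>\<^sup>+v. ennreal ((vdist d v (h q))\<^sup>2) \<partial>N q) \<le> ennreal (\<sigma>\<^sup>2)" if "q \<in> I" for q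
    using orcq(2)[OF that] by (simp add: N_def h_def)
  have hR: "h q \<in> Rd d" if "q \<in> I" for q
    using that g by (auto simp: h_def I_def has_gradient_def)
  have setsP: "sets (Pi\<^sub>M I N) = sets (Pi\<^sub>M I (\<lambda>_. borel_Rd d))"
    by (intro sets_PiM_cong refl sets)
  have avg: "avg \<in> Pi\<^sub>M I N \<rightarrow>\<^sub>M borel_Rd d"
    using measurable_minibatch_average[of M K d] measurable_cong_sets[OF setsP refl]
    by (auto simp: avg_def I_def n_def)
  have eq: "minibatch_oracle d M K orc x = distr (Pi\<^sub>M I N) (borel_Rd d) avg"
    by (simp add: minibatch_oracle_def I_def N_def[abs_def] avg_def n_def)
  have sumh: "(\<Sum>q\<in>I. h q i) / n = gbar i" for i
  proof -
    have "(\<Sum>q\<in>I. h q i) = (\<Sum>m<M. \<Sum>k<K. g m i)"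
      by (simp add: I_def h_def sum.cartesian_product case_prod_unfold del: sum_constant)
    also have "\<dots> = real K * (\<Sum>m<M. g m i)" by (simp add: sum_distrib_left)
    finally show ?thesis using K by (simp add: n_def gbar_def)
  qed
  show "has_bochner_integral (minibatch_oracle d M K orc x) (\<lambda>v. v i) (gbar i)" if i: "i < d" for i
  proof -
    have "has_bochner_integral (Pi\<^sub>M I N) (\<lambda>\<omega>. (\<Sum>q\<in>I. \<omega> q i) / n) ((\<Sum>q\<in>I. h q i) / n)"
      by (intro has_bochner_integral_divide_zero has_bochner_integral_sum
          has_bochner_integral_PiM_component[OF prob] mean i) auto
    then show ?thesis
      unfolding eq sumh
      by (intro has_bochner_integral_distr[OF measurable_borel_Rd_coordinate avg]) (simp add: avg_def)
  qed
  define V where "V q i = (\<integral>v. (v i - h q i)\<^sup>2 \<partial>N q)" for q i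
  have int: "integrable (N q) (\<lambda>v. (vdist d v (h q))\<^sup>2)" if q: "q \<in> I" for q
  proof -
    have "(\<lambda>v. vdist d v (h q)) \<in> borel_measurable (N q)"
      using hR[OF q] measurable_ident_sets[OF sets[OF q]] by (intro borel_measurable_vdist) auto
    then show ?thesis
      using var[OF q] by (intro integrableI_nonneg) (auto intro: le_less_trans)
  qed
  \<comment> \<open>Each coordinate inherits integrability from the full squared distance, which
    dominates it.\<close>
  have int_i: "integrable (N q) (\<lambda>v. (v i - h q i)\<^sup>2)" if q: "q \<in> I" and i: "i < d" for q i
  proof (rule Bochner_Integration.integrable_bound[OF int[OF q]])
    show "(\<lambda>v. (v i - h q i)\<^sup>2) \<in> borel_measurable (N q)"
      using mean[OF q i] by (auto simp: has_bochner_integral_iff)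
    show "AE v in N q. norm ((v i - h q i)\<^sup>2) \<le> norm ((vdist d v (h q))\<^sup>2)"
      using i by (auto simp: vdist_power2 sum_nonneg intro!: AE_I2 member_le_sum[of i "{..<d}" "\<lambda>i. (_ i - h q i)\<^sup>2"])
  qed
  have "(\<Sum>i<d. V q i) \<le> \<sigma>\<^sup>2" if q: "q \<in> I" for q
  proof -
    have "(\<Sum>i<d. V q i) = (\<integral>v. (vdist d v (h q))\<^sup>2 \<partial>N q)"
      unfolding vdist_power2 V_def using int_i[OF q]
      by (intro Bochner_Integration.integral_sum[symmetric]) auto
    also have "\<dots> \<le> \<sigma>\<^sup>2"
      using var[OF q] by (subst (asm) nn_integral_eq_integral[OF int[OF q]]) auto
    finally show ?thesis .
  qed
  then have Vsum: "(\<Sum>q\<in>I. \<Sum>i<d. V q i) \<le> n * \<sigma>\<^sup>2"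
    using sum_bounded_above[of I "\<lambda>q. \<Sum>i<d. V q i" "\<sigma>\<^sup>2"] by (simp add: n)
  have "has_bochner_integral (Pi\<^sub>M I N) (\<lambda>\<omega>. (\<Sum>q\<in>I. \<omega> q i - h q i)\<^sup>2) (\<Sum>q\<in>I. V q i)" if i: "i < d" for i
    unfolding V_def
  proof (rule variance_sum_PiM[where X = "\<lambda>q v. v i - h q i", OF I prob])
    fix q assume q: "q \<in> I"
    interpret prob_space "N q" by (rule prob[OF q])
    show "has_bochner_integral (N q) (\<lambda>v. v i - h q i) 0"
      using mean[OF q i] prob_space by (auto simp: has_bochner_integral_iff)
  qed (use int_i i in auto)
  then have "has_bochner_integral (Pi\<^sub>M I N) (\<lambda>\<omega>. (\<Sum>i<d. (\<Sum>q\<in>I. \<omega> q i - h q i)\<^sup>2) / n\<^sup>2)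
      ((\<Sum>i<d. \<Sum>q\<in>I. V q i) / n\<^sup>2)"
    by (intro has_bochner_integral_divide_zero has_bochner_integral_sum) auto
  moreover have "(\<Sum>i<d. (\<Sum>q\<in>I. \<omega> q i - h q i)\<^sup>2) / n\<^sup>2 = (vdist d (avg \<omega>) gbar)\<^sup>2" for \<omega>
    unfolding vdist_power2 sum_divide_distrib
    by (intro sum.cong) (simp_all add: avg_def sumh[symmetric] sum_subtractf diff_divide_distrib[symmetric] power_divide)
  ultimately have B: "has_bochner_integral (Pi\<^sub>M I N) (\<lambda>\<omega>. (vdist d (avg \<omega>) gbar)\<^sup>2)
      ((\<Sum>i<d. \<Sum>q\<in>I. V q i) / n\<^sup>2)"
    by simp
  have gR: "gbar \<in> Rd d" using hR g by (auto simp: gbar_def Rd_def has_gradient_def)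
  have "(\<integral>\<^sup>+v. ennreal ((vdist d v gbar)\<^sup>2) \<partial>minibatch_oracle d M K orc x)
      = (\<integral>\<^sup>+\<omega>. ennreal ((vdist d (avg \<omega>) gbar)\<^sup>2) \<partial>Pi\<^sub>M I N)"
    unfolding eq using gR
    by (intro nn_integral_distr avg measurable_compose[OF _ measurable_ennreal]
        borel_measurable_power borel_measurable_vdist) auto
  also have "\<dots> = ennreal ((\<Sum>i<d. \<Sum>q\<in>I. V q i) / n\<^sup>2)"
    using B by (subst nn_integral_eq_integral) (auto simp: has_bochner_integral_iff)
  also have "\<dots> \<le> ennreal (\<sigma>\<^sup>2 / n)"
  proof (rule ennreal_leI)
    have "(\<Sum>i<d. \<Sum>q\<in>I. V q i) / n\<^sup>2 \<le> (n * \<sigma>\<^sup>2) / n\<^sup>2"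
      using Vsum by (subst sum.swap) (simp add: divide_right_mono)
    then show "(\<Sum>i<d. \<Sum>q\<in>I. V q i) / n\<^sup>2 \<le> \<sigma>\<^sup>2 / n"
      using n by (simp add: power2_eq_square)
  qed
  finally show "(\<integral>\<^sup>+v. ennreal ((vdist d v gbar)\<^sup>2) \<partial>minibatch_oracle d M K orc x)
      \<le> ennreal (\<sigma>\<^sup>2 / (real M * real K))"
    by (simp add: n_def)
qed

subsection \<open>The schedule\<close>

lemma (in strongly_convex_objective) min_value_eq: "min_value d F = F u"
  unfolding min_value_def
proof (rule antisym)
  show "(INF x\<in>Rd d. F x) \<le> F u"
    using u_min by (intro cINF_lower u_Rd bdd_belowI2) auto
  show "F u \<le> (INF x\<in>Rd d. F x)"
    using u_Rd u_min by (intro cINF_greatest) auto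
qed

text \<open>\<open>F y - F u\<close> is nonnegative with finite nonnegative integral, hence
  integrable, and under a probability measure so is \<open>F\<close>; the guarantee thereby becomes
  a statement about the Bochner integral.\<close>

lemma (in stochastic_gradient) contracts_imp_suboptimality:
  assumes c: "contracts ss q n" and x: "x \<in> Rd d"
  shows "integrable (multistage_acsa d Q ss x) F"
    and "(\<integral>y. F y \<partial>multistage_acsa d Q ss x) - F u \<le> q * (F x - F u) + n"
proof -
  let ?\<mu> = "multistage_acsa d Q ss x"
  have A: "?\<mu> \<in> space (prob_algebra (borel_Rd d))"
    using measurable_space[OF measurable_multistage_acsa[OF kernel]] x by auto
  then have sets: "sets ?\<mu> = sets (borel_Rd d)" by (simp add: space_prob_algebra)
  interpret prob_space ?\<mu> using A by (simp add: space_prob_algebra)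
  have m: "F \<in> borel_measurable ?\<mu>"
    using F_measurable measurable_cong_sets[OF sets refl] by blast
  have nonneg: "AE y in ?\<mu>. 0 \<le> F y - F u"
    using u_min sets_eq_imp_space_eq[OF sets] by (intro AE_I2) auto
  have le: "(\<integral>\<^sup>+y. ennreal (F y - F u) \<partial>?\<mu>) \<le> ennreal (q * (F x - F u) + n)"
    using c x by (auto simp: contracts_def)
  have int: "integrable ?\<mu> (\<lambda>y. F y - F u)"
    using m nonneg le by (intro integrableI_nonneg) (auto intro: le_less_trans)
  then have "integrable ?\<mu> (\<lambda>y. (F y - F u) + F u)" by (intro Bochner_Integration.integrable_add) auto
  then show intF: "integrable ?\<mu> F" by simp
  have "0 \<le> q * (F x - F u) + n"
    using c u_min[OF x] by (auto simp: contracts_def)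
  then have "(\<integral>y. F y - F u \<partial>?\<mu>) \<le> q * (F x - F u) + n"
    using le by (simp add: nn_integral_eq_integral[OF int nonneg])
  then show "(\<integral>y. F y \<partial>?\<mu>) - F u \<le> q * (F x - F u) + n"
    using intF prob_space by simp
qed

text \<open>Smoothness provides a Lipschitz gradient map of the average only, while the oracles are
  centered at gradients of the components. Uniqueness of the gradient reconciles the two at every
  point.\<close>

lemma minibatch_stochastic_gradient:
  assumes Fs: "Fs \<in> het_objective_class d l H \<Delta> M"
    and orc: "\<And>m. m < M \<Longrightarrow> stochastic_gradient_oracle d \<sigma> (Fs m) (orc m)"
    and l: "0 < l" and H: "0 < H" and M: "1 \<le> M" and K: "1 \<le> K" and \<sigma>: "0 \<le> \<sigma>"
  obtains G u where "stochastic_gradient d l H (average_objective M Fs) G u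
    (minibatch_oracle d M K orc) (\<sigma>\<^sup>2 / (real M * real K))"
proof -
  let ?F = "average_objective M Fs"
  have sc: "strongly_convex d l ?F" and "smooth d H ?F"
    using Fs by (auto simp: het_objective_class_def objective_class_def)
  then obtain G where G: "\<And>x. x \<in> Rd d \<Longrightarrow> has_gradient d ?F x (G x)"
    and lip: "\<And>x y. x \<in> Rd d \<Longrightarrow> y \<in> Rd d \<Longrightarrow> vdist d (G x) (G y) \<le> H * vdist d x y"
    unfolding smooth_def by blast
  have "differentiable_Rd d ?F" using G by (auto simp: differentiable_Rd_def)
  then obtain u where u: "u \<in> Rd d" "\<And>x. x \<in> Rd d \<Longrightarrow> ?F u \<le> ?F x"
    using strongly_convex_minimizer[OF sc l] by blast
  have moments: "(\<forall>i<d. has_bochner_integral (minibatch_oracle d M K orc x) (\<lambda>v. v i) (G x i)) \<and>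
      (\<integral>\<^sup>+v. ennreal ((vdist d v (G x))\<^sup>2) \<partial>minibatch_oracle d M K orc x)
        \<le> ennreal (\<sigma>\<^sup>2 / (real M * real K))" if x: "x \<in> Rd d" for x
  proof -
    have "\<forall>m\<in>{..<M}. \<exists>g. has_gradient d (Fs m) x g"
      using Fs x by (auto simp: het_objective_class_def differentiable_Rd_def)
    then obtain g where g: "\<And>m. m < M \<Longrightarrow> has_gradient d (Fs m) x (g m)"
      by (metis lessThan_iff)
    have "G x = (\<lambda>i. (\<Sum>m<M. g m i) / real M)"
      by (rule has_gradient_unique[OF x G[OF x] has_gradient_average[OF g]])
    then show ?thesis using minibatch_oracle_moments[OF M K \<sigma> x orc g] by simp
  qed
  have "minibatch_oracle d M K orc \<in> borel_Rd d \<rightarrow>\<^sub>M prob_algebra (borel_Rd d)"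
    using orc by (intro measurable_minibatch_oracle) (simp add: stochastic_gradient_oracle_def)
  then have "stochastic_gradient d l H ?F G u (minibatch_oracle d M K orc) (\<sigma>\<^sup>2 / (real M * real K))"
    using l H sc G lip u moments by unfold_locales auto
  then show ?thesis by (rule that)
qed

section \<open>Stage lengths and the budget of rounds\<close>

definition doubling_schedule :: "real \<Rightarrow> nat \<Rightarrow> nat \<Rightarrow> nat \<Rightarrow> nat \<Rightarrow> (real \<times> real) list list" where
  "doubling_schedule l T N m r =
    (replicate N (stage l T) @ map (\<lambda>k. stage l (T * 2 ^ k)) [0..<m]) @ [replicate r (1, 0)]"

lemma length_stage: "length (stage l T) = T"
  by (simp add: stage_def stage_params_def)

lemma stage_params_admissible: "0 < l \<Longrightarrow> (b, c) \<in> set (stage l T) \<Longrightarrow> 1 \<le> b \<and> 0 \<le> c"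
  by (auto simp: stage_def stage_params_def)

text \<open>The working stages use T N plus the geometric sum T (2^m - 1), and the idle stage takes
  the rest. As 2^m \<ge> 1, the inner natural subtraction does not truncate; the hypothesis ensures
  the same for the subtraction from \<open>R\<close>.\<close>

lemma stage_schedule_doubling:
  assumes "0 < l" "T * (N + 2 ^ m) \<le> R"
  shows "stage_schedule R (doubling_schedule l T N m (R - T * (N + 2 ^ m - 1)))"
proof -
  have "(\<Sum>k\<leftarrow>[0..<m]. T * 2 ^ k) = T * (2 ^ m - 1)"
    by (induction m) (auto simp: diff_mult_distrib2)
  then have "sum_list (map length (doubling_schedule l T N m r)) = T * N + T * (2 ^ m - 1) + r" for r
    by (simp add: doubling_schedule_def length_stage o_def sum_list_replicate)
  also have "T * N + T * (2 ^ m - 1) + (R - T * (N + 2 ^ m - 1)) = R"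
  proof -
    have "T * N + T * (2 ^ m - 1) = T * (N + 2 ^ m - 1)"
      by (simp add: add_mult_distrib2[symmetric])
    moreover have "T * (N + 2 ^ m - 1) \<le> T * (N + 2 ^ m)" by (intro mult_left_mono) auto
    ultimately show ?thesis using assms(2) by linarith
  qed
  finally show ?thesis
    using assms(1) stage_params_admissible
    by (fastforce simp: stage_schedule_def doubling_schedule_def)
qed

text \<open>From e \<le> 3; it turns the factor 1/4 per stage into an exponential.\<close>

lemma quarter_le_exp: "(1/4 :: real) \<le> exp (-1)"
  using exp_le by (simp add: exp_minus field_simps)

text \<open>Rounding up adds less than 1, which is at most sqrt (H / l) because H is at least
  l.\<close>

lemma basic_stage_length:
  fixes l H :: real
  assumes "0 < l" "9 * l \<le> H"
  defines "T \<equiv> nat \<lceil>8 * sqrt (H / l)\<rceil>"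
  shows "1 \<le> sqrt (H / l)" "8 * sqrt (H / l) \<le> real T" "real T \<le> 9 * sqrt (H / l)"
proof -
  have "sqrt 1 \<le> sqrt (H / l)" using assms by (intro real_sqrt_le_mono) (simp add: field_simps)
  then show "1 \<le> sqrt (H / l)" by simp
  then show "8 * sqrt (H / l) \<le> real T" "real T \<le> 9 * sqrt (H / l)"
    unfolding T_def by linarith+
qed

text \<open>At most half of the budget goes to stages of length \<open>T\<close> and at most half to
  the doubling ones, with N and 2^m both of the order of R / T. R < 4 T N and T \<le> 9 sqrt (H / l)
  give the rate 1/36, and R < 8 T 2^m raises the noise constant 64 to 512.\<close>

lemma doubling_schedule_rates:
  fixes l H s2 :: real and R T :: nat
  assumes l: "0 < l" "9 * l \<le> H" and s2: "0 \<le> s2"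
    and T: "T = nat \<lceil>8 * sqrt (H / l)\<rceil>" and R: "2 * T \<le> R"
  obtains N m where "64 * H \<le> l * (real T)\<^sup>2" "T * (N + 2 ^ m) \<le> R"
    "(1/4) ^ N \<le> exp (- (1/36 * sqrt l * real R / sqrt H))"
    "64 * s2 / (l * real (T * 2 ^ m)) \<le> 512 * (s2 / (l * real R))"
proof -
  define w where "w = sqrt (H / l)"
  have H: "0 < H" using l by linarith
  have w: "1 \<le> w" and Tr: "8 * w \<le> real T" "real T \<le> 9 * w"
    using basic_stage_length[OF l] by (simp_all add: w_def T)
  have "(8 * w)\<^sup>2 \<le> (real T)\<^sup>2" using Tr w by (intro power_mono) auto
  then have TH: "64 * H \<le> l * (real T)\<^sup>2"
    using l H by (simp add: w_def power_mult_distrib field_simps)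
  have T0: "0 < T" using Tr w by (cases T) auto
  \<comment> \<open>At least 1 because 2 T \<le> R; 2^m will be the largest power of two not
    exceeding it.\<close>
  define N where "N = R div (2 * T)"
  have N1: "1 \<le> N" using R T0 by (simp add: N_def Suc_le_eq div_greater_zero_iff)
  obtain m where m: "2 ^ m \<le> N" "N < 2 ^ (m + 1)" using ex_power_ivl1[OF order_refl N1] by blast
  have NR: "N * (2 * T) \<le> R" by (simp add: N_def)
  have "R < (N + 1) * (2 * T)"
    using dividend_less_div_times[of "2 * T" R] T0 by (simp add: N_def algebra_simps)
  also have "\<dots> \<le> N * (4 * T)" using mult_right_mono[OF N1, of "2 * T"] by simp
  finally have RN: "R < N * (4 * T)" .
  have "T * (N + 2 ^ m) \<le> T * (N + N)" using m by (intro mult_left_mono) auto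
  also have "\<dots> \<le> R" using NR by (simp add: algebra_simps)
  finally have budget: "T * (N + 2 ^ m) \<le> R" .
  have "real R \<le> real N * (4 * real T)" using RN by (metis less_imp_le of_nat_le_iff of_nat_mult of_nat_numeral)
  also have "\<dots> \<le> real N * (36 * w)" using Tr by (intro mult_left_mono) auto
  finally have "1/36 * (real R / w) \<le> real N" using w by (simp add: field_simps)
  moreover have "sqrt l * real R / sqrt H = real R / w"
    by (simp add: w_def real_sqrt_divide)
  ultimately have ex: "1/36 * sqrt l * real R / sqrt H \<le> real N" by simp
  have "(1/4 :: real) ^ N \<le> exp (-1) ^ N" by (rule power_mono[OF quarter_le_exp]) simp
  also have "\<dots> = exp (- real N)" by (simp add: exp_of_nat_mult[symmetric])
  also have "\<dots> \<le> exp (- (1/36 * sqrt l * real R / sqrt H))" using ex by simp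
  finally have bias: "(1/4) ^ N \<le> exp (- (1/36 * sqrt l * real R / sqrt H))" .
  have "R < 8 * (T * 2 ^ m)"
  proof -
    have "N * (4 * T) \<le> 2 ^ (m + 1) * (4 * T)" using m by (intro mult_right_mono) auto
    also have "\<dots> = 8 * (T * 2 ^ m)" by simp
    finally show ?thesis using RN by linarith
  qed
  then have "real R \<le> 8 * real (T * 2 ^ m)" by linarith
  moreover define P where "P = real (T * 2 ^ m)"
  ultimately have "s2 * real R \<le> s2 * (8 * P)" using s2 by (intro mult_left_mono) auto
  moreover have "0 < real R" "0 < P" using R T0 by (auto simp: P_def)
  ultimately have "64 * s2 / (l * P) \<le> 512 * (s2 / (l * real R))"
    using l(1) by (simp add: field_simps)
  then have "64 * s2 / (l * real (T * 2 ^ m)) \<le> 512 * (s2 / (l * real R))"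
    unfolding P_def .
  then show ?thesis using that[OF TH budget bias] by blast
qed

theorem theorem20:
  "\<exists>c>0. \<exists>c'>0. \<forall>(M::nat) (K::nat) (R::nat) (l::real) (H::real) (\<Delta>::real) (\<sigma>::real).
     1 \<le> M \<and> 1 \<le> K \<and> 1 \<le> R \<and> 0 < l \<and> 9 * l \<le> H \<and> 0 < \<Delta> \<and> 0 \<le> \<sigma> \<longrightarrow>
     (\<exists>stages. stage_schedule R stages \<and>
        (\<forall>d Fs orc.
           Fs \<in> het_objective_class d l H \<Delta> M \<and>
           (\<forall>m<M. stochastic_gradient_oracle d \<sigma> (Fs m) (orc m)) \<longrightarrow>
           integrable (minibatch_acsa d M K orc stages) (average_objective M Fs) \<and>
           (\<integral>x. average_objective M Fs x \<partial>minibatch_acsa d M K orc stages)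
               - min_value d (average_objective M Fs)
             \<le> c * (\<Delta> * exp (- (c' * sqrt l * real R / sqrt H))
                    + min (\<sigma>\<^sup>2 / (l * real M * real K * real R)) \<Delta>)))"
proof (rule exI[of _ "512::real"], intro exI[of _ "1/36::real"] conjI allI impI)
  fix M K R :: nat and l H \<Delta> \<sigma> :: real
  assume "1 \<le> M \<and> 1 \<le> K \<and> 1 \<le> R \<and> 0 < l \<and> 9 * l \<le> H \<and> 0 < \<Delta> \<and> 0 \<le> \<sigma>"
  then have M: "1 \<le> M" and K: "1 \<le> K" and R: "1 \<le> R" and l: "0 < l" "9 * l \<le> H"
    and \<Delta>: "0 < \<Delta>" and \<sigma>: "0 \<le> \<sigma>" by auto
  have H: "0 < H" using l by linarith
  define s2 where "s2 = \<sigma>\<^sup>2 / (real M * real K)"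
  have s2: "0 \<le> s2" by (simp add: s2_def)
  have s2R: "\<sigma>\<^sup>2 / (l * real M * real K * real R) = s2 / (l * real R)"
    by (simp add: s2_def)
  define bound where "bound = 512 * (\<Delta> * exp (- (1/36 * sqrt l * real R / sqrt H))
    + min (s2 / (l * real R)) \<Delta>)"
  define T where "T = nat \<lceil>8 * sqrt (H / l)\<rceil>"
  have min0: "0 \<le> min (s2 / (l * real R)) \<Delta>" using s2 l \<Delta> by simp
  \<comment> \<open>The schedule is produced before the objective and the oracles are known, so what
    is asked of it is one pair \<open>q\<close>, \<open>n\<close> that serves every instance of the
    locale with variance bound \<open>s2\<close>.\<close>
  have reduce: "\<exists>stages. stage_schedule R stages \<and> (\<forall>d Fs orc.
      Fs \<in> het_objective_class d l H \<Delta> M \<and>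
      (\<forall>m<M. stochastic_gradient_oracle d \<sigma> (Fs m) (orc m)) \<longrightarrow>
      integrable (minibatch_acsa d M K orc stages) (average_objective M Fs) \<and>
      (\<integral>x. average_objective M Fs x \<partial>minibatch_acsa d M K orc stages)
        - min_value d (average_objective M Fs) \<le> bound)"
    if sched: "stage_schedule R ss" and q: "0 \<le> q" "q * \<Delta> + n \<le> bound"
      and con: "\<And>d F G u Q. stochastic_gradient d l H F G u Q s2 \<Longrightarrow>
        stochastic_gradient.contracts d F u Q ss q n" for ss q n
  proof (intro exI conjI allI impI)
    fix d Fs orc
    assume "Fs \<in> het_objective_class d l H \<Delta> M \<and>
      (\<forall>m<M. stochastic_gradient_oracle d \<sigma> (Fs m) (orc m))"
    then have Fs: "Fs \<in> het_objective_class d l H \<Delta> M"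
      and orc: "\<And>m. m < M \<Longrightarrow> stochastic_gradient_oracle d \<sigma> (Fs m) (orc m)" by auto
    obtain G u where sg: "stochastic_gradient d l H (average_objective M Fs) G u
        (minibatch_oracle d M K orc) s2"
      using minibatch_stochastic_gradient[OF Fs orc l(1) H M K \<sigma>] unfolding s2_def by blast
    interpret stochastic_gradient d l H "average_objective M Fs" G u "minibatch_oracle d M K orc" s2
      by (rule sg)
    have zero: "(\<lambda>_. 0) \<in> Rd d" by (simp add: Rd_def)
    note sub = contracts_imp_suboptimality[OF con[OF sg] zero]
    show "integrable (minibatch_acsa d M K orc ss) (average_objective M Fs)"
      using sub(1) by (simp add: minibatch_acsa_def)
    have "average_objective M Fs (\<lambda>_. 0) - average_objective M Fs u \<le> \<Delta>"
      using Fs by (simp add: het_objective_class_def objective_class_def min_value_eq)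
    then have "q * (average_objective M Fs (\<lambda>_. 0) - average_objective M Fs u) \<le> q * \<Delta>"
      using q by (intro mult_left_mono) auto
    then show "(\<integral>x. average_objective M Fs x \<partial>minibatch_acsa d M K orc ss)
        - min_value d (average_objective M Fs) \<le> bound"
      using sub(2) q by (simp add: minibatch_acsa_def min_value_eq)
  qed (rule sched)
  have "\<exists>ss q n. stage_schedule R ss \<and> 0 \<le> q \<and> q * \<Delta> + n \<le> bound \<and>
    (\<forall>d F G u Q. stochastic_gradient d l H F G u Q s2 \<longrightarrow>
      stochastic_gradient.contracts d F u Q ss q n)"
  proof (cases "R < 2 * T \<or> \<Delta> \<le> s2 / (l * real R)")
    case True
    have "\<Delta> \<le> bound"
      using True
    proof
      \<comment> \<open>Then R \<le> 18 sqrt (H / l), so the exponent is at most 1/2 in absolute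
        value; the exponential is at least 1/4, and the factor 512 covers \<Delta>.\<close>
      assume "R < 2 * T"
      moreover have "real T \<le> 9 * sqrt (H / l)"
        using basic_stage_length(3)[OF l] by (simp add: T_def)
      ultimately have "real R \<le> 18 * sqrt (H / l)" by linarith
      then have "1/36 * sqrt l * real R / sqrt H \<le> 1/2"
        using l H by (simp add: real_sqrt_divide field_simps)
      then have "exp (-1) \<le> exp (- (1/36 * sqrt l * real R / sqrt H))"
        unfolding exp_le_cancel_iff by linarith
      from mult_left_mono[OF order_trans[OF quarter_le_exp this] less_imp_le[OF \<Delta>]]
      have "\<Delta> * (1/4) \<le> \<Delta> * exp (- (1/36 * sqrt l * real R / sqrt H))" .
      then show ?thesis using min0 \<Delta> unfolding bound_def distrib_left by linarith
    next
      assume "\<Delta> \<le> s2 / (l * real R)"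
      moreover have "0 \<le> \<Delta> * exp (- (1/36 * sqrt l * real R / sqrt H))" using \<Delta> by simp
      ultimately show ?thesis using \<Delta> unfolding bound_def distrib_left min_def by auto
    qed
    then show ?thesis
      by (intro exI[of _ "[replicate R (1, 0)]"] exI[of _ 1] exI[of _ 0])
        (auto simp: stage_schedule_def intro: stochastic_gradient.contracts_idle)
  next
    case False
    then obtain N m where T: "64 * H \<le> l * (real T)\<^sup>2" and budget: "T * (N + 2 ^ m) \<le> R"
      and bias: "(1/4) ^ N \<le> exp (- (1/36 * sqrt l * real R / sqrt H))"
      and noise: "64 * s2 / (l * real (T * 2 ^ m)) \<le> 512 * (s2 / (l * real R))"
      using doubling_schedule_rates[OF l s2 T_def] by (metis not_less)
    let ?n = "64 * s2 / (l * real (T * 2 ^ m))"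
    have "(1/4) ^ N * \<Delta> \<le> exp (- (1/36 * sqrt l * real R / sqrt H)) * \<Delta>"
      using bias \<Delta> by (intro mult_right_mono) auto
    moreover have "0 \<le> exp (- (1/36 * sqrt l * real R / sqrt H)) * \<Delta>" using \<Delta> by simp
    \<comment> \<open>In this case the noise level is below \<Delta>, so the minimum is the very
      term that \<open>noise\<close> bounds.\<close>
    moreover have "min (s2 / (l * real R)) \<Delta> = s2 / (l * real R)" using False by simp
    ultimately have "(1/4) ^ N * \<Delta> + ?n \<le> bound"
      using noise unfolding bound_def distrib_left by (simp add: mult.commute[of \<Delta>])
    moreover have "stochastic_gradient.contracts d F u Q
        (doubling_schedule l T N m (R - T * (N + 2 ^ m - 1))) ((1/4) ^ N) ?n"
      if "stochastic_gradient d l H F G u Q s2" for d F G u Q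
    proof -
      interpret stochastic_gradient d l H F G u Q s2 by (rule that)
      show ?thesis
        using contracts_append[OF contracts_doubling[OF T] contracts_idle]
        by (simp add: doubling_schedule_def)
    qed
    ultimately show ?thesis
      using stage_schedule_doubling[OF l(1) budget]
      by (intro exI[of _ "doubling_schedule l T N m (R - T * (N + 2 ^ m - 1))"]
          exI[of _ "(1/4) ^ N"] exI[of _ ?n]) auto
  qed
  then show "\<exists>stages. stage_schedule R stages \<and> (\<forall>d Fs orc.
      Fs \<in> het_objective_class d l H \<Delta> M \<and>
      (\<forall>m<M. stochastic_gradient_oracle d \<sigma> (Fs m) (orc m)) \<longrightarrow>
      integrable (minibatch_acsa d M K orc stages) (average_objective M Fs) \<and>
      (\<integral>x. average_objective M Fs x \<partial>minibatch_acsa d M K orc stages)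
        - min_value d (average_objective M Fs)
      \<le> 512 * (\<Delta> * exp (- (1/36 * sqrt l * real R / sqrt H))
        + min (\<sigma>\<^sup>2 / (l * real M * real K * real R)) \<Delta>))"
    unfolding s2R bound_def[symmetric] using reduce by blast
qed auto

end
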